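(* Let $\rho\ge0$ and consider the Lorentz force $F_{e_1,\rho}$ on $H_3$ with its canonical metric. For every $\mathcal E>0$ there are infinitely many periodic magnetic trajectories $\gamma$ for $F_{e_1,\rho}$ with energy $\mathcal E$ through the identity, $\gamma(0)=e$, $\gamma'(0)=x_0e_1+y_0e_2+z_0e_3$, with $x_0\ge0$. More precisely, there exists exactly one $c>1$ such that the periodic magnetic trajectories associated to the triples $(c,d_c,e)$, $e\in[-1,1]$, have energy $\mathcal E$.
   Context: The Heisenberg group $H_3$ is $\mathbb{R}^3$ with product $(x_1,y_1,z_1)(x_2,y_2,z_2)=(x_1+x_2,\,y_1+y_2,\,z_1+z_2+\tfrac12(x_1y_2-x_2y_1))$. Its Lie algebra $\mathfrak h_3$ has basis of left-invariant fields $e_1=\partial_x-\tfrac12 y\,\partial_z$, $e_2=\partial_y+\tfrac12 x\,\partial_z$, $e_3=\partial_z$, with $[e_1,e_2]=e_3$. The canonical metric is the left-invariant metric for which $e_1,e_2,e_3$ is orthonormal. $F_{e_1,\rho}$ is the left-invariant skew-symmetric $(1,1)$-tensor with $F e_1=\rho e_2+e_3$, $F e_2=-\rho e_1$, $F e_3=-e_1$. A magnetic trajectory is a curve $\gamma:\mathbb{R}\to H_3$ with $\nabla_{\gamma'}\gamma'=F\gamma'$; its energy is $\tfrac12|\gamma'(0)|^2$. It is periodic if $\gamma(t+\omega)=\gamma(t)$ for all $t$, for some $\omega>0$. The magnetic trajectory associated to a triple $(c,d,e)\in(0,\infty)\times(0,1)\times[-1,1]$ is the one with $\gamma(0)$ the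 identity and $\gamma'(0)=x_0e_1+y_0e_2+z_0e_3$, where $$x_0=\tfrac{2d}{c}\sqrt{1-e^2}\,\sqrt{(c^3de+\rho)^2+(1-d^2)c^6},\quad y_0=c^2(2d^2e^2-2d^2+1)+\tfrac{2de\rho}{c}-1,\quad z_0=\tfrac{\rho}{c^2}+2cde-\rho.$$ For each $c>1$ there is a unique $d_c\in(0,1)$, independent of $e$, such that the trajectories associated to $(c,d_c,e)$, $e\in[-1,1]$, are periodic. (In these formulas $e$ is a real parameter, not the identity of the group.) *)

theory Defs
  imports "HOL-Analysis.Analysis"
begin

text \<open>
  Levi-Civita connection of a Riemannian metric on the single chart \<open>real^'n\<close>.  A metric is a
  function \<open>g\<close> such that \<open>g p u v\<close> is the inner product of the tangent vectors \<open>u\<close>, \<open>v\<close> at \<open>p\<close>.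
\<close>

type_synonym 'n metric = "real^'n \<Rightarrow> real^'n \<Rightarrow> real^'n \<Rightarrow> real"

definition gram :: "'n::finite metric \<Rightarrow> real^'n \<Rightarrow> real^'n^'n" where
  "gram g p = (\<chi> i j. g p (axis i 1) (axis j 1))"

definition partial :: "'n::finite \<Rightarrow> (real^'n \<Rightarrow> real) \<Rightarrow> real^'n \<Rightarrow> real" where
  "partial i f p = frechet_derivative f (at p) (axis i 1)"

definition christoffel :: "'n::finite metric \<Rightarrow> real^'n \<Rightarrow> 'n \<Rightarrow> 'n \<Rightarrow> 'n \<Rightarrow> real" where
  "christoffel g p k i j = (1/2) * (\<Sum>l\<in>UNIV. matrix_inv (gram g p) $ k $ l *
     (partial i (\<lambda>q. gram g q $ j $ l) p + partial j (\<lambda>q. gram g q $ i $ l) p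
      - partial l (\<lambda>q. gram g q $ i $ j) p))"

abbreviation velocity :: "(real \<Rightarrow> 'a::real_normed_vector) \<Rightarrow> real \<Rightarrow> 'a" where
  "velocity \<gamma> t \<equiv> vector_derivative \<gamma> (at t)"

text \<open>The covariant derivative of the velocity field of \<open>\<gamma>\<close> along \<open>\<gamma>\<close>.\<close>

definition cov_accel :: "'n::finite metric \<Rightarrow> (real \<Rightarrow> real^'n) \<Rightarrow> real \<Rightarrow> real^'n" where
  "cov_accel g \<gamma> t = (\<chi> k. velocity (velocity \<gamma>) t $ k
     + (\<Sum>i\<in>UNIV. \<Sum>j\<in>UNIV. christoffel g (\<gamma> t) k i j * velocity \<gamma> t $ i * velocity \<gamma> t $ j))"


text \<open>The Heisenberg group on \<open>real^3\<close>; its identity element is \<open>0\<close>.\<close>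

definition heis_mult :: "real^3 \<Rightarrow> real^3 \<Rightarrow> real^3" where
  "heis_mult p q = vector [p$1 + q$1, p$2 + q$2, p$3 + q$3 + (1/2) * (p$1 * q$2 - q$1 * p$2)]"

definition e1 :: "real^3 \<Rightarrow> real^3" where "e1 p = vector [1, 0, - (1/2) * p$2]"
definition e2 :: "real^3 \<Rightarrow> real^3" where "e2 p = vector [0, 1, (1/2) * p$1]"
definition e3 :: "real^3 \<Rightarrow> real^3" where "e3 p = vector [0, 0, 1]"

text \<open>Components of a tangent vector at \<open>p\<close> in the frame \<open>e1, e2, e3\<close>; see \<open>frame_coords\<close> below.\<close>

definition coords :: "real^3 \<Rightarrow> real^3 \<Rightarrow> real^3" where
  "coords p v = vector [v$1, v$2, v$3 + (1/2) * (p$2 * v$1 - p$1 * v$2)]"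

definition heis_metric :: "3 metric" where
  "heis_metric p u v = coords p u \<bullet> coords p v"

text \<open>The Lorentz force, the linear extension of \<open>F e1 = \<rho> e2 + e3\<close>, \<open>F e2 = - \<rho> e1\<close>, \<open>F e3 = - e1\<close>.\<close>

definition lorentz :: "real \<Rightarrow> real^3 \<Rightarrow> real^3 \<Rightarrow> real^3" where
  "lorentz \<rho> p v = coords p v $ 1 *\<^sub>R (\<rho> *\<^sub>R e2 p + e3 p)
                 + coords p v $ 2 *\<^sub>R (- \<rho> *\<^sub>R e1 p)
                 + coords p v $ 3 *\<^sub>R (- e1 p)"

lemma heis_mult_identity: "heis_mult 0 p = p" "heis_mult p 0 = p"
  by (simp_all add: heis_mult_def vec_eq_iff forall_3)

lemma frame_coords: "coords p v $ 1 *\<^sub>R e1 p + coords p v $ 2 *\<^sub>R e2 p + coords p v $ 3 *\<^sub>R e3 p = v"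
  by (simp add: coords_def e1_def e2_def e3_def vec_eq_iff forall_3 algebra_simps)

lemma heis_metric_orthonormal:
  "heis_metric p (e1 p) (e1 p) = 1" "heis_metric p (e2 p) (e2 p) = 1" "heis_metric p (e3 p) (e3 p) = 1"
  "heis_metric p (e1 p) (e2 p) = 0" "heis_metric p (e1 p) (e3 p) = 0" "heis_metric p (e2 p) (e3 p) = 0"
  by (simp_all add: heis_metric_def coords_def e1_def e2_def e3_def inner_vec_def sum_3)

lemma heis_mult_has_derivative:
  "(heis_mult q has_derivative (\<lambda>v. vector [v$1, v$2, v$3 + (1/2) * (q$1 * v$2 - v$1 * q$2)])) (at p)"
proof -
  let ?L = "\<lambda>v::real^3. vector [v$1, v$2, v$3 + (1/2) * (q$1 * v$2 - v$1 * q$2)] :: real^3"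
  have "linear ?L"
    by (rule linearI) (simp_all add: vec_eq_iff forall_3 algebra_simps)
  then have "((\<lambda>v. ?L v + q) has_derivative ?L) (at p)"
    by (intro has_derivative_add_const bounded_linear_imp_has_derivative)
       (simp add: linear_conv_bounded_linear)
  moreover have "heis_mult q = (\<lambda>v. ?L v + q)"
    by (simp add: fun_eq_iff heis_mult_def vec_eq_iff forall_3)
  ultimately show ?thesis by simp
qed

lemma frame_left_invariant:
  "frechet_derivative (heis_mult q) (at p) (e1 p) = e1 (heis_mult q p)"
  "frechet_derivative (heis_mult q) (at p) (e2 p) = e2 (heis_mult q p)"
  "frechet_derivative (heis_mult q) (at p) (e3 p) = e3 (heis_mult q p)"
  unfolding frechet_derivative_at[OF heis_mult_has_derivative, symmetric]
  by (simp_all add: heis_mult_def e1_def e2_def e3_def vec_eq_iff forall_3 field_simps)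


definition magnetic_trajectory :: "real \<Rightarrow> (real \<Rightarrow> real^3) \<Rightarrow> bool" where
  "magnetic_trajectory \<rho> \<gamma> \<longleftrightarrow>
     (\<forall>t. \<gamma> differentiable at t) \<and> (\<forall>t. velocity \<gamma> differentiable at t) \<and>
     (\<forall>t. cov_accel heis_metric \<gamma> t = lorentz \<rho> (\<gamma> t) (velocity \<gamma> t))"

definition energy :: "(real \<Rightarrow> real^3) \<Rightarrow> real" where
  "energy \<gamma> = (1/2) * heis_metric (\<gamma> 0) (velocity \<gamma> 0) (velocity \<gamma> 0)"

definition periodic :: "(real \<Rightarrow> 'a) \<Rightarrow> bool" where
  "periodic \<gamma> \<longleftrightarrow> (\<exists>\<omega>>0. \<forall>t. \<gamma> (t + \<omega>) = \<gamma> t)"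

definition x0 :: "real \<Rightarrow> real \<Rightarrow> real \<Rightarrow> real \<Rightarrow> real" where
  "x0 \<rho> c d e = (2 * d / c) * sqrt (1 - e^2) * sqrt ((c^3 * d * e + \<rho>)^2 + (1 - d^2) * c^6)"

definition y0 :: "real \<Rightarrow> real \<Rightarrow> real \<Rightarrow> real \<Rightarrow> real" where
  "y0 \<rho> c d e = c^2 * (2 * d^2 * e^2 - 2 * d^2 + 1) + 2 * d * e * \<rho> / c - 1"

definition z0 :: "real \<Rightarrow> real \<Rightarrow> real \<Rightarrow> real \<Rightarrow> real" where
  "z0 \<rho> c d e = \<rho> / c^2 + 2 * c * d * e - \<rho>"

text \<open>\<open>\<gamma>\<close> is the magnetic trajectory associated to the triple \<open>(c, d, e)\<close>.\<close>

definition associated :: "real \<Rightarrow> real \<Rightarrow> real \<Rightarrow> real \<Rightarrow> (real \<Rightarrow> real^3) \<Rightarrow> bool" where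
  "associated \<rho> c d e \<gamma> \<longleftrightarrow>
     magnetic_trajectory \<rho> \<gamma> \<and> \<gamma> 0 = 0 \<and>
     velocity \<gamma> 0 = x0 \<rho> c d e *\<^sub>R e1 0 + y0 \<rho> c d e *\<^sub>R e2 0 + z0 \<rho> c d e *\<^sub>R e3 0"

text \<open>The number \<open>d\<^sub>c\<close>, which depends on \<open>\<rho>\<close> as well; meaningful for \<open>c > 1\<close>.\<close>

definition d_per :: "real \<Rightarrow> real \<Rightarrow> real" where
  "d_per \<rho> c = (THE d. 0 < d \<and> d < 1 \<and>
     (\<forall>e\<in>{-1..1}. \<exists>\<gamma>. associated \<rho> c d e \<gamma> \<and> periodic \<gamma>))"

end

theory Submission
  imports Defs
begin

text \<open>
  Put \<open>u = x + z\<^sub>0 + \<rho>\<close> and \<open>\<beta> = y' + 1\<close>. The magnetic equation becomes \<open>\<beta> = u\<^sup>2/2 + K\<close>,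
  \<open>u'' = \<rho> - \<beta> u\<close>, while \<open>z\<close> is an explicit polynomial in \<open>u\<close>, \<open>u'\<close>, \<open>y\<close>. So the trajectory is
  periodic iff the mean of \<open>\<beta>\<close> over a period of \<open>u\<close> is 1. A real Moebius substitution, fixing the
  turning points of \<open>u\<close>, removes the linear term of the quartic satisfied by \<open>u'\<close>, and the mean
  of \<open>\<beta>\<close> becomes \<open>c\<^sup>2 (S g(m) - r\<^sup>2)\<close> with \<open>r = \<rho> / c\<^sup>3\<close>, \<open>S\<^sup>2 = (1 + r\<^sup>2)\<^sup>2 - 4 r\<^sup>2 d\<^sup>2\<close>,
  \<open>g = 2 E / K - 1\<close> a ratio of complete elliptic integrals, and parameter \<open>m\<close> given by
  \<open>S (1 - 2 m) = 1 + r\<^sup>2 - 2 d\<^sup>2\<close>.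

  In terms of \<open>\<tau> = \<rho>\<^sup>2 / c\<^sup>4\<close>, \<open>\<nu> = 1 / g(m)\<close> and \<open>G = \<nu>\<^sup>2 - 2 \<nu> (1 - 2 m) + 1\<close> the closing condition
  and the energy are \<open>c\<^sup>4 + \<tau> = (1 + \<tau>) (\<nu>\<^sup>2 + \<tau> G)\<close> and \<open>2 \<E> = (1 + \<tau>)\<^sup>3 G\<close>. Since \<open>\<nu>\<close> and \<open>G\<close> increase
  with \<open>m\<close>, the first equation has one solution \<open>m\<close> for given \<open>c\<close>, which gives \<open>d\<^sub>c\<close>. For given \<open>\<E>\<close> the
  second one expresses \<open>\<tau>\<close> by \<open>m\<close>, and then \<open>\<rho>\<^sup>2 = \<tau> c\<^sup>4\<close> is strictly decreasing in \<open>m\<close>, by the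
  Riccati equation for \<open>g\<close>; hence exactly one \<open>c\<close> belongs to \<open>\<rho>\<close> and \<open>\<E>\<close>.
\<close>

subsection \<open>The magnetic equation in coordinates\<close>

lemma partial_eq:
  assumes "(f has_derivative f') (at p)"
  shows "partial i f p = f' (axis i 1)"
  using frechet_derivative_at[OF assms] by (simp add: partial_def)

lemma gram_heis_metric:
  "gram heis_metric p = vector
     [vector [1 + (p$2)^2 / 4, - (p$1 * p$2 / 4), p$2 / 2],
      vector [- (p$1 * p$2 / 4), 1 + (p$1)^2 / 4, - (p$1 / 2)],
      vector [p$2 / 2, - (p$1 / 2), 1]]"
  by (simp add: gram_def heis_metric_def coords_def vec_eq_iff forall_3 inner_vec_def sum_3
      axis_def power2_eq_square field_simps)

text \<open>\<open>matrix_inv\<close> merely chooses some two-sided inverse, so the explicit matrix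
  is checked to be one and then identified by uniqueness of inverses.\<close>

lemma matrix_inv_gram_heis_metric:
  "matrix_inv (gram heis_metric p) = vector
     [vector [1, 0, - (p$2 / 2)],
      vector [0, 1, p$1 / 2],
      vector [- (p$2 / 2), p$1 / 2, 1 + ((p$1)^2 + (p$2)^2) / 4]]" (is "_ = ?B")
proof -
  have AB: "gram heis_metric p ** ?B = mat 1"
    by (simp add: gram_heis_metric matrix_matrix_mult_def mat_def vec_eq_iff forall_3 sum_3
        power2_eq_square field_simps)
  then have BA: "?B ** gram heis_metric p = mat 1"
    using matrix_left_right_inverse by blast
  have "matrix_inv (gram heis_metric p) ** gram heis_metric p = mat 1"
    unfolding matrix_inv_def by (rule someI2[where a = ?B]) (simp_all only: AB BA)
  then have "?B = matrix_inv (gram heis_metric p) ** (gram heis_metric p ** ?B)"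
    by (simp only: matrix_mul_assoc matrix_mul_lid)
  then show ?thesis
    by (simp only: AB matrix_mul_rid)
qed

text \<open>The five shapes are those of the entries in \<open>gram_heis_metric\<close>, so the
  Christoffel symbols can be computed by rewriting.\<close>

lemma partial_poly:
  fixes p :: "real^3"
  shows "partial l (\<lambda>q. c) p = 0"
    "partial l (\<lambda>q. q$i / 2) p = axis l 1 $ i / 2"
    "partial l (\<lambda>q. - (q$i / 2)) p = - (axis l 1 $ i) / 2"
    "partial l (\<lambda>q. 1 + (q$i)^2 / 4) p = axis l 1 $ i * p$i / 2"
    "partial l (\<lambda>q. - (q$i * q$j / 4)) p = - (axis l 1 $ i * p$j + p$i * axis l 1 $ j) / 4"
proof -
  note intros = derivative_eq_intros bounded_linear.has_derivative[OF bounded_linear_vec_nth] refl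
  show "partial l (\<lambda>q. c) p = 0"
    by (rule trans[OF partial_eq]) (rule intros)+
  show "partial l (\<lambda>q. q$i / 2) p = axis l 1 $ i / 2"
    by (rule trans[OF partial_eq]) (rule intros | simp)+
  show "partial l (\<lambda>q. - (q$i / 2)) p = - (axis l 1 $ i) / 2"
    by (rule trans[OF partial_eq]) (rule intros | simp)+
  show "partial l (\<lambda>q. 1 + (q$i)^2 / 4) p = axis l 1 $ i * p$i / 2"
    by (rule trans[OF partial_eq]) (rule intros | simp)+
  show "partial l (\<lambda>q. - (q$i * q$j / 4)) p = - (axis l 1 $ i * p$j + p$i * axis l 1 $ j) / 4"
    by (rule trans[OF partial_eq]) (rule intros | simp add: field_simps)+
qed

text \<open>\<open>w\<close> is the \<open>e3\<close> component of the velocity; in terms of it the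
  double sum over Christoffel symbols collapses.\<close>

lemma cov_accel_heis:
  fixes \<gamma> :: "real \<Rightarrow> real^3" and t :: real
  defines "p \<equiv> \<gamma> t" and "V \<equiv> velocity \<gamma> t" and "A \<equiv> velocity (velocity \<gamma>) t"
  defines "w \<equiv> V$3 + (p$2 * V$1 - p$1 * V$2) / 2"
  shows "cov_accel heis_metric \<gamma> t =
    vector [A$1 + V$2 * w, A$2 - V$1 * w, A$3 - w * (p$1 * V$1 + p$2 * V$2) / 2]"
  unfolding cov_accel_def p_def[symmetric] V_def[symmetric] A_def[symmetric]
  unfolding christoffel_def matrix_inv_gram_heis_metric
  by (simp add: vec_eq_iff forall_3 sum_3 gram_heis_metric partial_poly axis_def w_def)
    (simp add: field_simps power2_eq_square)

lemma has_vector_derivative_vector_3: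
  fixes x y z :: "real \<Rightarrow> real"
  assumes "(x has_field_derivative x') (at t)" "(y has_field_derivative y') (at t)"
    "(z has_field_derivative z') (at t)"
  shows "((\<lambda>t. vector [x t, y t, z t] :: real^3) has_vector_derivative vector [x', y', z']) (at t)"
proof -
  have expand: "vector [p, q, r] = p *\<^sub>R axis 1 1 + q *\<^sub>R axis 2 1 + r *\<^sub>R (axis 3 1 :: real^3)" for p q r
    by (simp add: vec_eq_iff forall_3 axis_def)
  show ?thesis
    unfolding expand using assms
    by (auto intro!: derivative_eq_intros)
qed

lemma has_field_derivative_component:
  fixes \<gamma> :: "real \<Rightarrow> real^'n"
  assumes "\<gamma> differentiable at t"
  shows "((\<lambda>t. \<gamma> t $ i) has_field_derivative velocity \<gamma> t $ i) (at t)"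
  using bounded_linear.has_vector_derivative[OF bounded_linear_vec_nth, of \<gamma> "velocity \<gamma> t" "at t" i] assms
  by (simp add: vector_derivative_works has_real_derivative_iff_has_vector_derivative)

lemma lorentz_heis:
  fixes p V :: "real^3" and \<rho> :: real
  defines "w \<equiv> V$3 + (p$2 * V$1 - p$1 * V$2) / 2"
  shows "lorentz \<rho> p V = vector [- \<rho> * V$2 - w, \<rho> * V$1,
    V$1 + \<rho> * p$1 * V$1 / 2 + p$2 * (\<rho> * V$2 + w) / 2]"
  by (simp add: lorentz_def coords_def e1_def e2_def e3_def vec_eq_iff forall_3 w_def)
    (simp add: field_simps)

text \<open>By left invariance the position drops out of the equations for the frame components
  \<open>a\<close>, \<open>b\<close>, \<open>w\<close>. The last two rules are the source of the
  first integrals in \<open>associatedD\<close>.\<close>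

lemma magnetic_trajectoryD:
  fixes \<gamma> :: "real \<Rightarrow> real^3"
  assumes mag: "magnetic_trajectory \<rho> \<gamma>"
  defines "a \<equiv> \<lambda>t. velocity \<gamma> t $ 1" and "b \<equiv> \<lambda>t. velocity \<gamma> t $ 2"
  defines "w \<equiv> \<lambda>t. velocity \<gamma> t $ 3 + (\<gamma> t $ 2 * a t - \<gamma> t $ 1 * b t) / 2"
  shows "((\<lambda>t. \<gamma> t $ 1) has_field_derivative a t) (at t)"
    "((\<lambda>t. \<gamma> t $ 2) has_field_derivative b t) (at t)"
    "(a has_field_derivative - (b t * w t) - \<rho> * b t - w t) (at t)"
    "(b has_field_derivative a t * (w t + \<rho>)) (at t)"
    "(w has_field_derivative a t) (at t)"
proof -
  have diff: "\<gamma> differentiable at t" "velocity \<gamma> differentiable at t" for t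
    using mag by (auto simp: magnetic_trajectory_def)
  have "cov_accel heis_metric \<gamma> t = lorentz \<rho> (\<gamma> t) (velocity \<gamma> t)" 
    using mag by (simp add: magnetic_trajectory_def)
  then have acc: "velocity (velocity \<gamma>) t $ 1 = - (b t * w t) - \<rho> * b t - w t"
    "velocity (velocity \<gamma>) t $ 2 = a t * (w t + \<rho>)"
    "velocity (velocity \<gamma>) t $ 3 = w t * (\<gamma> t $ 1 * a t + \<gamma> t $ 2 * b t) / 2 + a t
      + \<rho> * \<gamma> t $ 1 * a t / 2 + \<gamma> t $ 2 * (\<rho> * b t + w t) / 2"
    unfolding cov_accel_heis lorentz_heis
    by (simp_all add: vec_eq_iff forall_3 a_def b_def w_def algebra_simps)
  show x: "((\<lambda>t. \<gamma> t $ 1) has_field_derivative a t) (at t)"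
    and y: "((\<lambda>t. \<gamma> t $ 2) has_field_derivative b t) (at t)"
    unfolding a_def b_def using diff by (auto intro: has_field_derivative_component)
  show a: "(a has_field_derivative - (b t * w t) - \<rho> * b t - w t) (at t)"
    using has_field_derivative_component[OF diff(2)[of t], of 1] acc(1) by (simp add: a_def)
  show b: "(b has_field_derivative a t * (w t + \<rho>)) (at t)"
    using has_field_derivative_component[OF diff(2)[of t], of 2] acc(2) by (simp add: b_def)
  have "((\<lambda>t. velocity \<gamma> t $ 3) has_field_derivative w t * (\<gamma> t $ 1 * a t + \<gamma> t $ 2 * b t) / 2 + a t
      + \<rho> * \<gamma> t $ 1 * a t / 2 + \<gamma> t $ 2 * (\<rho> * b t + w t) / 2) (at t)"
    using has_field_derivative_component[OF diff(2)[of t], of 3] acc(3) by simp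
  then show "(w has_field_derivative a t) (at t)"
    unfolding w_def
    by (rule DERIV_cong[OF DERIV_add[OF _ DERIV_cdivide[OF DERIV_diff[OF DERIV_mult[OF y a] DERIV_mult[OF x b]]]]])
      (simp add: w_def field_simps)
qed

text \<open>Converse of \<open>magnetic_trajectoryD\<close>: the derivative prescribed for
  \<open>z\<close> undoes the passage from the third coordinate to the \<open>e3\<close> component.
  The velocity is recorded for reading off initial data.\<close>

lemma magnetic_trajectoryI:
  fixes x y z a b w :: "real \<Rightarrow> real" and \<rho> :: real
  assumes x: "\<And>t. (x has_field_derivative a t) (at t)"
    and y: "\<And>t. (y has_field_derivative b t) (at t)"
    and z: "\<And>t. (z has_field_derivative w t + (x t * b t - y t * a t) / 2) (at t)"
    and a: "\<And>t. (a has_field_derivative - (b t * w t) - \<rho> * b t - w t) (at t)"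
    and b: "\<And>t. (b has_field_derivative a t * (w t + \<rho>)) (at t)"
    and w: "\<And>t. (w has_field_derivative a t) (at t)"
  defines "\<gamma> \<equiv> \<lambda>t. vector [x t, y t, z t] :: real^3"
  shows "magnetic_trajectory \<rho> \<gamma>"
    "velocity \<gamma> t = vector [a t, b t, w t + (x t * b t - y t * a t) / 2]"
proof -
  have d: "(\<gamma> has_vector_derivative vector [a t, b t, w t + (x t * b t - y t * a t) / 2]) (at t)" for t
    unfolding \<gamma>_def by (intro has_vector_derivative_vector_3 x y z)
  then have v: "velocity \<gamma> = (\<lambda>t. vector [a t, b t, w t + (x t * b t - y t * a t) / 2])"
    by (auto simp: vector_derivative_at)
  have vt: "velocity \<gamma> t = vector [a t, b t, w t + (x t * b t - y t * a t) / 2]" for t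
    using fun_cong[OF v, of t] by simp
  then show "velocity \<gamma> t = vector [a t, b t, w t + (x t * b t - y t * a t) / 2]" .
  define z2 where "z2 t = a t + (x t * (a t * (w t + \<rho>)) - y t * (- (b t * w t) - \<rho> * b t - w t)) / 2" for t
  have dd: "(velocity \<gamma> has_vector_derivative
      vector [- (b t * w t) - \<rho> * b t - w t, a t * (w t + \<rho>), z2 t]) (at t)" for t
    unfolding v z2_def
    by (intro has_vector_derivative_vector_3 a b)
      (rule derivative_eq_intros x y a b w refl | simp add: field_simps)+
  then have vv: "velocity (velocity \<gamma>) t =
      vector [- (b t * w t) - \<rho> * b t - w t, a t * (w t + \<rho>), z2 t]" for t
    by (auto simp: vector_derivative_at)
  have "\<gamma> t $ 1 = x t" "\<gamma> t $ 2 = y t" for t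
    by (simp_all add: \<gamma>_def)
  then have "cov_accel heis_metric \<gamma> t = lorentz \<rho> (\<gamma> t) (velocity \<gamma> t)" for t
    unfolding cov_accel_heis lorentz_heis vv unfolding vt
    by (simp add: vec_eq_iff forall_3 z2_def) (simp add: field_simps)
  then show "magnetic_trajectory \<rho> \<gamma>"
    unfolding magnetic_trajectory_def using d dd by (auto intro: differentiableI_vector)
qed

subsection \<open>Reduction to a scalar equation\<close>

lemma frame_at_identity: "x *\<^sub>R e1 0 + y *\<^sub>R e2 0 + z *\<^sub>R e3 0 = vector [x, y, z]"
  by (simp add: e1_def e2_def e3_def vec_eq_iff forall_3)

lemma energy_associated:
  assumes "associated \<rho> c d e \<gamma>"
  shows "energy \<gamma> = ((x0 \<rho> c d e)^2 + (y0 \<rho> c d e)^2 + (z0 \<rho> c d e)^2) / 2"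
  using assms
  by (simp add: associated_def frame_at_identity energy_def heis_metric_def coords_def
      inner_vec_def sum_3 power2_eq_square)

text \<open>A Duffing equation with constant forcing \<rho>, as a first-order system;
  \<open>K\<close> is the constant of integration in the formula for \<beta>.\<close>

definition magnetic_profile :: "real \<Rightarrow> real \<Rightarrow> (real \<Rightarrow> real) \<Rightarrow> (real \<Rightarrow> real) \<Rightarrow> bool" where
  "magnetic_profile \<rho> K U A \<longleftrightarrow>
     (\<forall>t. (U has_field_derivative A t) (at t) \<and>
          (A has_field_derivative \<rho> - ((U t)^2 / 2 + K) * U t) (at t))"

text \<open>The third coordinate needs no integration: \<open>a' = - b u - (u - \<rho>)\<close> makes its derivative exact.\<close>

lemma associatedI:
  fixes U A Y :: "real \<Rightarrow> real"
  assumes prof: "magnetic_profile \<rho> K U A"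
    and Y: "\<And>t. (Y has_field_derivative (U t)^2 / 2 + K - 1) (at t)"
    and init: "U 0 = z0 \<rho> c d e + \<rho>" "A 0 = x0 \<rho> c d e" "Y 0 = 0"
    and K: "K = y0 \<rho> c d e + 1 - (z0 \<rho> c d e + \<rho>)^2 / 2"
  shows "associated \<rho> c d e (\<lambda>t. vector [U t - U 0, Y t, A 0 - A t - Y t * (U t + U 0) / 2])"
proof -
  have U: "(U has_field_derivative A t) (at t)"
    and A: "(A has_field_derivative \<rho> - ((U t)^2 / 2 + K) * U t) (at t)" for t
    using prof by (auto simp: magnetic_profile_def)
  define b where "b t = (U t)^2 / 2 + K - 1" for t
  define w where "w t = U t - \<rho>" for t
  note I = magnetic_trajectoryI[where x = "\<lambda>t. U t - U 0" and y = Y and a = A and b = b and w = w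
      and \<rho> = \<rho> and z = "\<lambda>t. A 0 - A t - Y t * (U t + U 0) / 2"]
  have x': "((\<lambda>t. U t - U 0) has_field_derivative A t) (at t)" for t
    by (rule derivative_eq_intros U refl | simp)+
  have y': "(Y has_field_derivative b t) (at t)" for t
    using Y by (simp add: b_def)
  have z': "((\<lambda>t. A 0 - A t - Y t * (U t + U 0) / 2) has_field_derivative
        w t + ((U t - U 0) * b t - Y t * A t) / 2) (at t)" for t
    unfolding b_def w_def
    by (rule derivative_eq_intros U A Y refl | simp add: field_simps power2_eq_square)+
  have a': "(A has_field_derivative - (b t * w t) - \<rho> * b t - w t) (at t)" for t
    by (rule DERIV_cong[OF A]) (simp add: b_def w_def field_simps power2_eq_square)
  have b': "(b has_field_derivative A t * (w t + \<rho>)) (at t)" for t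
    unfolding b_def[abs_def] w_def by (rule derivative_eq_intros U refl | simp)+
  have w': "(w has_field_derivative A t) (at t)" for t
    unfolding w_def[abs_def] by (rule derivative_eq_intros U refl | simp)+
  note d = x' y' z' a' b' w'
  have "b 0 = y0 \<rho> c d e" "w 0 = z0 \<rho> c d e"
    using K init by (simp_all add: b_def w_def)
  then show ?thesis
    unfolding associated_def frame_at_identity
    using I(1)[OF d] I(2)[OF d, of 0] init
    by (simp add: vec_eq_iff forall_3)
qed

text \<open>Both \<open>w - U\<close> and \<open>b - U^2 / 2\<close> have derivative zero along the
  trajectory; their values at time 0 express \<open>w\<close> and \<open>b\<close> through
  \<open>U\<close>.\<close>

lemma associatedD:
  fixes \<gamma> :: "real \<Rightarrow> real^3"
  assumes "associated \<rho> c d e \<gamma>"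
    and K: "K = y0 \<rho> c d e + 1 - (z0 \<rho> c d e + \<rho>)^2 / 2"
  defines "U \<equiv> \<lambda>t. \<gamma> t $ 1 + z0 \<rho> c d e + \<rho>" and "A \<equiv> \<lambda>t. velocity \<gamma> t $ 1"
  shows "magnetic_profile \<rho> K U A"
    "((\<lambda>t. \<gamma> t $ 2) has_field_derivative (U t)^2 / 2 + K - 1) (at t)"
    "U 0 = z0 \<rho> c d e + \<rho>" "A 0 = x0 \<rho> c d e" "\<gamma> 0 $ 2 = 0"
proof -
  have mag: "magnetic_trajectory \<rho> \<gamma>" and \<gamma>0: "\<gamma> 0 = 0"
    and v0: "velocity \<gamma> 0 = vector [x0 \<rho> c d e, y0 \<rho> c d e, z0 \<rho> c d e]"
    using assms by (auto simp: associated_def frame_at_identity)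
  define b where "b t = velocity \<gamma> t $ 2" for t
  define w where "w t = velocity \<gamma> t $ 3 + (\<gamma> t $ 2 * A t - \<gamma> t $ 1 * b t) / 2" for t
  have A: "velocity \<gamma> t $ 1 = A t" for t
    by (simp add: A_def)
  note d = magnetic_trajectoryD[OF mag, folded b_def, unfolded A, folded w_def]
  have U: "(U has_field_derivative A t) (at t)" for t
    unfolding U_def by (rule derivative_eq_intros d(1) refl | simp)+
  have "((\<lambda>t. w t - U t) has_field_derivative 0) (at t)" for t
    by (rule derivative_eq_intros d U refl | simp)+
  then have "w t - U t = w 0 - U 0" for t
    using DERIV_isconst_all by blast
  moreover have "w 0 = z0 \<rho> c d e"
    by (simp add: w_def v0 \<gamma>0)
  ultimately have w: "w t = U t - \<rho>" for t
    by (simp add: U_def \<gamma>0 algebra_simps)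
  have "((\<lambda>t. b t - (U t)^2 / 2) has_field_derivative 0) (at t)" for t
    by (rule derivative_eq_intros d U refl | simp add: w)+
  then have "b t - (U t)^2 / 2 = b 0 - (U 0)^2 / 2" for t
    using DERIV_isconst_all by blast
  moreover have "b 0 = y0 \<rho> c d e"
    by (simp add: b_def v0)
  ultimately have b: "b t = (U t)^2 / 2 + K - 1" for t
    by (simp add: U_def \<gamma>0 K algebra_simps)
  show "magnetic_profile \<rho> K U A"
    unfolding magnetic_profile_def
    using U by (auto intro!: DERIV_cong[OF d(3)] simp: w b field_simps)
  show "((\<lambda>t. \<gamma> t $ 2) has_field_derivative (U t)^2 / 2 + K - 1) (at t)"
    using d(2) b by simp
  show "U 0 = z0 \<rho> c d e + \<rho>" "A 0 = x0 \<rho> c d e" "\<gamma> 0 $ 2 = 0"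
    by (simp_all add: U_def A_def v0 \<gamma>0)
qed

text \<open>\<open>H\<close> corresponds to the squared speed of the trajectory, which a skew force
  conserves. The bound supplies the Lipschitz constant for uniqueness.\<close>

lemma magnetic_profile_bounded:
  assumes "magnetic_profile \<rho> K U A"
  obtains R where "\<And>t. \<bar>U t\<bar> \<le> R"
proof -
  define H where "H t = (A t)^2 + ((U t)^2 / 2 + K - 1)^2 + (U t - \<rho>)^2" for t
  have U: "(U has_field_derivative A t) (at t)"
    and A: "(A has_field_derivative \<rho> - ((U t)^2 / 2 + K) * U t) (at t)" for t
    using assms by (auto simp: magnetic_profile_def)
  have "(H has_field_derivative 0) (at t)" for t
    unfolding H_def
    by (rule derivative_eq_intros U A refl | simp add: field_simps power2_eq_square)+
  then have H: "H t = H 0" for t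
    using DERIV_isconst_all by blast
  have "\<bar>U t\<bar> \<le> sqrt (H 0) + \<bar>\<rho>\<bar>" for t
  proof -
    have "(U t - \<rho>)^2 \<le> H t"
      by (simp add: H_def)
    then have "\<bar>U t - \<rho>\<bar> \<le> sqrt (H 0)"
      using H[of t] by (simp add: real_le_rsqrt)
    then show ?thesis by linarith
  qed
  then show thesis by (rule that)
qed

text \<open>Gronwall's argument for the squared distance \<open>W\<close> in the phase plane:
  \<open>W' \<le> L * W\<close> makes \<open>exp (- L * t) * W t\<close> nonincreasing, and it
  starts at 0.\<close>

lemma magnetic_profile_unique:
  assumes p1: "magnetic_profile \<rho> K U1 A1" and p2: "magnetic_profile \<rho> K U2 A2"
    and init: "U1 0 = U2 0" "A1 0 = A2 0" and t: "t \<ge> 0"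
  shows "U1 t = U2 t"
proof -
  obtain R1 where R1: "\<bar>U1 t\<bar> \<le> R1" for t using magnetic_profile_bounded[OF p1] by blast
  obtain R2 where R2: "\<bar>U2 t\<bar> \<le> R2" for t using magnetic_profile_bounded[OF p2] by blast
  define R where "R = max R1 R2"
  have R: "\<bar>U1 t\<bar> \<le> R" "\<bar>U2 t\<bar> \<le> R" for t
    using R1[of t] R2[of t] by (auto simp: R_def)
  have d: "(U1 has_field_derivative A1 t) (at t)" "(U2 has_field_derivative A2 t) (at t)"
     "(A1 has_field_derivative \<rho> - ((U1 t)^2 / 2 + K) * U1 t) (at t)" 
     "(A2 has_field_derivative \<rho> - ((U2 t)^2 / 2 + K) * U2 t) (at t)" for t
    using p1 p2 by (auto simp: magnetic_profile_def)
  define W where "W t = (U1 t - U2 t)^2 + (A1 t - A2 t)^2" for t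
  \<comment> \<open>\<open>N\<close> is the divided difference of the cubic
    \<open>(U^2 / 2 + K) * U\<close>; \<open>L\<close> bounds \<open>1 - N\<close> in absolute value
    along both solutions.\<close>
  define N where "N t = ((U1 t)^2 + U1 t * U2 t + (U2 t)^2) / 2 + K" for t
  define L where "L = 3 * R^2 / 2 + \<bar>K\<bar> + 1"
  have W': "(W has_field_derivative 2 * (1 - N t) * ((U1 t - U2 t) * (A1 t - A2 t))) (at t)" for t
    unfolding W_def N_def
    by (rule derivative_eq_intros d refl | simp add: field_simps power2_eq_square power3_eq_cube)+
  have W'_le: "2 * (1 - N t) * ((U1 t - U2 t) * (A1 t - A2 t)) \<le> L * W t" for t
  proof -
    have prod: "\<bar>x * y\<bar> \<le> R^2" if "\<bar>x\<bar> \<le> R" "\<bar>y\<bar> \<le> R" for x y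
      using mult_mono[OF that(1) that(2) order_trans[OF abs_ge_zero that(1)] abs_ge_zero]
      by (simp only: abs_mult power2_eq_square)
    have "\<bar>1 - ((x + y + z) / 2 + K)\<bar> \<le> 3 * r / 2 + \<bar>K\<bar> + 1"
      if "\<bar>x\<bar> \<le> r" "\<bar>y\<bar> \<le> r" "\<bar>z\<bar> \<le> r" for x y z r :: real
      using that by (auto simp: abs_le_iff add_divide_distrib)
    then have "\<bar>1 - N t\<bar> \<le> L"
      unfolding N_def L_def power2_eq_square[of "U1 t"] power2_eq_square[of "U2 t"]
      by (metis prod R)
    moreover have "2 * \<bar>(U1 t - U2 t) * (A1 t - A2 t)\<bar> \<le> W t"
      using sum_squares_bound[of "\<bar>U1 t - U2 t\<bar>" "\<bar>A1 t - A2 t\<bar>"] by (simp add: W_def abs_mult)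
    ultimately have "\<bar>1 - N t\<bar> * (2 * \<bar>(U1 t - U2 t) * (A1 t - A2 t)\<bar>) \<le> L * W t"
      by (intro mult_mono) (auto simp: L_def)
    moreover have "2 * (1 - N t) * ((U1 t - U2 t) * (A1 t - A2 t))
        \<le> \<bar>1 - N t\<bar> * (2 * \<bar>(U1 t - U2 t) * (A1 t - A2 t)\<bar>)"
    proof -
      have eq: "2 * (1 - N t) * P = 2 * ((1 - N t) * P)" "\<bar>1 - N t\<bar> * (2 * \<bar>P\<bar>) = 2 * \<bar>(1 - N t) * P\<bar>" for P
        by (simp_all only: abs_mult mult_ac)
      show ?thesis
        unfolding eq by simp
    qed
    ultimately show ?thesis by linarith
  qed
  define G where "G t = exp (- L * t) * W t" for t
  have G': "(G has_field_derivative
      exp (- L * t) * (2 * (1 - N t) * ((U1 t - U2 t) * (A1 t - A2 t)) - L * W t)) (at t)" for t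
    unfolding G_def by (rule derivative_eq_intros W' refl | simp add: algebra_simps)+
  have "G t \<le> G 0"
    using t
    by (rule DERIV_nonpos_imp_nonincreasing) (use G' W'_le in \<open>force simp: mult_le_0_iff\<close>)
  also have "G 0 = 0"
    by (simp add: G_def W_def init)
  finally have "W t \<le> 0"
    by (simp add: G_def mult_le_0_iff)
  then show ?thesis
    by (simp add: W_def sum_power2_le_zero_iff)
qed

text \<open>The second coordinate at nonnegative times is all that the drift argument in
  \<open>ex_periodic_associated_iff\<close> compares.\<close>

lemma associated_unique:
  assumes "associated \<rho> c d e \<gamma>" "associated \<rho> c d e \<gamma>'" "t \<ge> 0"
  shows "\<gamma> t $ 2 = \<gamma>' t $ 2"
proof -
  define K where "K = y0 \<rho> c d e + 1 - (z0 \<rho> c d e + \<rho>)^2 / 2"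
  note D = associatedD[OF assms(1) K_def] and D' = associatedD[OF assms(2) K_def]
  have x: "\<gamma> s $ 1 = \<gamma>' s $ 1" if "s \<ge> 0" for s
    using magnetic_profile_unique[OF D(1) D'(1) _ _ that] D(3,4) D'(3,4) by simp
  have "((\<lambda>t. \<gamma> t $ 2 - \<gamma>' t $ 2) has_field_derivative 0) (at s)" if "s \<ge> 0" for s
    using DERIV_diff[OF D(2)[of s] D'(2)[of s]] x[OF that] by simp
  note der = this
  have "continuous_on {0..t} (\<lambda>t. \<gamma> t $ 2 - \<gamma>' t $ 2)"
    by (rule continuous_at_imp_continuous_on) (use DERIV_isCont[OF der] in auto)
  then have "\<gamma> t $ 2 - \<gamma>' t $ 2 = \<gamma> 0 $ 2 - \<gamma>' 0 $ 2"
    using DERIV_isconst_end[of 0 t "\<lambda>t. \<gamma> t $ 2 - \<gamma>' t $ 2"] assms(3) der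
    by (cases "t = 0") auto
  then show ?thesis
    using D(5) D'(5) by simp
qed

subsection \<open>A ratio of complete elliptic integrals\<close>

definition Delta :: "real \<Rightarrow> real \<Rightarrow> real" where
  "Delta m \<phi> = sqrt (1 - m * (sin \<phi>)^2)"

text \<open>Integrals over a full turn, the period of the angle in the explicit solution; hence four
  times the classical complete integrals with parameter \<open>m\<close>. The factor cancels in
  \<open>ell_ratio\<close>.\<close>

definition ellK :: "real \<Rightarrow> real" where "ellK m = integral {0..2*pi} (\<lambda>\<phi>. 1 / Delta m \<phi>)"
definition ellE :: "real \<Rightarrow> real" where "ellE m = integral {0..2*pi} (Delta m)"

definition ell_ratio :: "real \<Rightarrow> real" where "ell_ratio m = 2 * ellE m / ellK m - 1"

lemma Delta_radicand_pos: "m < 1 \<Longrightarrow> 0 < 1 - m * (sin \<phi>)^2" for m \<phi> :: real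
proof -
  assume m: "m < 1"
  have s: "0 \<le> (sin \<phi>)^2" "(sin \<phi>)^2 \<le> 1"
    using sin_cos_squared_add[of \<phi>] zero_le_power2[of "cos \<phi>"] by (simp, linarith)
  show "0 < 1 - m * (sin \<phi>)^2"
  proof (cases "m \<le> 0")
    case True
    then have "m * (sin \<phi>)^2 \<le> 0"
      using s by (simp add: mult_nonpos_nonneg)
    then show ?thesis by linarith
  next
    case False
    then have "m * (sin \<phi>)^2 \<le> m"
      using s by (simp add: mult_left_le)
    then show ?thesis using m by linarith
  qed
qed

lemma Delta_pos: "m < 1 \<Longrightarrow> 0 < Delta m \<phi>"
  using Delta_radicand_pos[of m \<phi>] by (simp add: Delta_def)

lemma Delta_sq: "m < 1 \<Longrightarrow> (Delta m \<phi>)^2 = 1 - m * (sin \<phi>)^2"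
  using Delta_radicand_pos[of m \<phi>] by (simp add: Delta_def)

lemma Delta_periodic: "Delta m (\<phi> + 2 * pi) = Delta m \<phi>"
  by (simp add: Delta_def)

lemma continuous_on_Delta [continuous_intros]:
  fixes f g :: "'a::t2_space \<Rightarrow> real"
  shows "continuous_on S f \<Longrightarrow> continuous_on S g \<Longrightarrow> continuous_on S (\<lambda>x. Delta (f x) (g x))"
  unfolding Delta_def
  by (intro continuous_on_real_sqrt continuous_on_diff continuous_on_mult continuous_on_power
      continuous_on_const continuous_on_sin)

lemma DERIV_Delta:
  assumes "m < 1"
  shows "(Delta m has_field_derivative - (m * sin \<phi> * cos \<phi> / Delta m \<phi>)) (at \<phi>)"
proof -
  have "((\<lambda>\<phi>. 1 - m * (sin \<phi>)^2) has_field_derivative - (m * (2 * sin \<phi> * cos \<phi>))) (at \<phi>)"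
    by (auto intro!: derivative_eq_intros)
  from DERIV_chain2[OF DERIV_real_sqrt[OF Delta_radicand_pos[OF assms]] this]
  show ?thesis
    unfolding Delta_def[abs_def] by (simp add: field_simps)
qed

lemma DERIV_Delta_param:
  assumes "m < 1"
  shows "((\<lambda>m. Delta m \<phi>) has_field_derivative - ((sin \<phi>)^2 / (2 * Delta m \<phi>))) (at m within S)"
proof -
  have "((\<lambda>m. 1 - m * (sin \<phi>)^2) has_field_derivative - ((sin \<phi>)^2)) (at m within S)"
    by (auto intro!: derivative_eq_intros)
  from DERIV_chain2[OF DERIV_real_sqrt[OF Delta_radicand_pos[OF assms]] this]
  show ?thesis
    unfolding Delta_def[abs_def] by (simp add: field_simps)
qed

lemma integrable_ell:
  assumes "m < 1"
  shows "Delta m integrable_on {0..2*pi}" "(\<lambda>\<phi>. 1 / Delta m \<phi>) integrable_on {0..2*pi}"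
    "(\<lambda>\<phi>. 1 / (Delta m \<phi>)^3) integrable_on {0..2*pi}"
proof -
  have "Delta m \<phi> \<noteq> 0" for \<phi>
    using Delta_pos[OF assms, of \<phi>] by simp
  then show "Delta m integrable_on {0..2*pi}" "(\<lambda>\<phi>. 1 / Delta m \<phi>) integrable_on {0..2*pi}"
    "(\<lambda>\<phi>. 1 / (Delta m \<phi>)^3) integrable_on {0..2*pi}"
    by (auto intro!: integrable_continuous_real continuous_intros)
qed

text \<open>The function \<open>m * sin \<phi> * cos \<phi> / Delta m \<phi>\<close> has derivative
  \<open>Delta - (1 - m) / Delta^3\<close> and vanishes at both ends of the interval.\<close>

lemma integral_inverse_Delta_cube:
  assumes m: "m < 1"
  shows "integral {0..2*pi} (\<lambda>\<phi>. 1 / (Delta m \<phi>)^3) = ellE m / (1 - m)"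
proof -
  have "((\<lambda>\<phi>. m * sin \<phi> * cos \<phi> / Delta m \<phi>) has_field_derivative
      Delta m \<phi> - (1 - m) / (Delta m \<phi>)^3) (at \<phi> within {0..2*pi})" for \<phi>
  proof -
    note pos = Delta_pos[OF m, of \<phi>]
    have s: "m * (sin \<phi>)^2 = 1 - (Delta m \<phi>)^2"
      using Delta_sq[OF m, of \<phi>] by simp
    have "m * (cos \<phi>)^2 = m - m * (sin \<phi>)^2"
      by (simp add: cos_squared_eq algebra_simps)
    then have c: "m * (cos \<phi>)^2 = m - 1 + (Delta m \<phi>)^2"
      using s by simp
    have "(m * cos \<phi> * cos \<phi> - m * sin \<phi> * sin \<phi>) * Delta m \<phi> ^ 2 + (m * sin \<phi> * cos \<phi>) * (m * sin \<phi> * cos \<phi>)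
      = (m * (cos \<phi>)^2 - m * (sin \<phi>)^2) * Delta m \<phi> ^ 2 + (m * (sin \<phi>)^2) * (m * (cos \<phi>)^2)"
      by (simp add: power2_eq_square algebra_simps)
    also have "\<dots> = Delta m \<phi> ^ 4 - (1 - m)"
      unfolding s c by (simp add: algebra_simps power2_eq_square power4_eq_xxxx)
    finally have "(m * cos \<phi> * cos \<phi> - m * sin \<phi> * sin \<phi>) * Delta m \<phi> ^ 2 + (m * sin \<phi> * cos \<phi>) * (m * sin \<phi> * cos \<phi>)
        = Delta m \<phi> ^ 4 - (1 - m)" .
    then have "(m * cos \<phi> * cos \<phi> - m * sin \<phi> * sin \<phi>) / Delta m \<phi> + (m * sin \<phi> * cos \<phi>) * (m * sin \<phi> * cos \<phi>) / Delta m \<phi> ^ 3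
        = Delta m \<phi> - (1 - m) / (Delta m \<phi>)^3"
      (is "?X / _ + ?Z / _ = _")
    proof -
      have "?X / Delta m \<phi> + ?Z / Delta m \<phi> ^ 3 = (?X * Delta m \<phi> ^ 2 + ?Z) / Delta m \<phi> ^ 3"
        using pos by (simp add: add_divide_distrib power2_eq_square power3_eq_cube)
      also assume "?X * Delta m \<phi> ^ 2 + ?Z = Delta m \<phi> ^ 4 - (1 - m)"
      also have "(Delta m \<phi> ^ 4 - (1 - m)) / Delta m \<phi> ^ 3 = Delta m \<phi> - (1 - m) / (Delta m \<phi>)^3"
        using pos by (simp add: diff_divide_distrib power4_eq_xxxx power3_eq_cube)
      finally show ?thesis .
    qed
    moreover have "((\<lambda>\<phi>. m * sin \<phi> * cos \<phi> / Delta m \<phi>) has_field_derivative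
      (m * cos \<phi> * cos \<phi> - m * sin \<phi> * sin \<phi>) / Delta m \<phi> + (m * sin \<phi> * cos \<phi>) * (m * sin \<phi> * cos \<phi>) / Delta m \<phi> ^ 3) (at \<phi> within {0..2*pi})"
      using pos
      by (auto intro!: derivative_eq_intros DERIV_subset[OF DERIV_Delta[OF m]])
        (simp add: field_simps power2_eq_square power3_eq_cube)
    ultimately show ?thesis by simp
  qed
  then have "((\<lambda>\<phi>. Delta m \<phi> - (1 - m) / (Delta m \<phi>)^3) has_integral
      m * sin (2*pi) * cos (2*pi) / Delta m (2*pi) - m * sin 0 * cos 0 / Delta m 0) {0..2*pi}"
    by (intro fundamental_theorem_of_calculus)
      (auto simp: has_real_derivative_iff_has_vector_derivative)
  then have "((\<lambda>\<phi>. Delta m \<phi> - (1 - m) * (1 / (Delta m \<phi>)^3)) has_integral 0) {0..2*pi}"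
    by simp
  moreover have "((\<lambda>\<phi>. Delta m \<phi> - (1 - m) * (1 / (Delta m \<phi>)^3)) has_integral
      ellE m - (1 - m) * integral {0..2*pi} (\<lambda>\<phi>. 1 / (Delta m \<phi>)^3)) {0..2*pi}"
    unfolding ellE_def using integrable_ell[OF m]
    by (intro has_integral_diff has_integral_mult_right integrable_integral)
  ultimately have "0 = ellE m - (1 - m) * integral {0..2*pi} (\<lambda>\<phi>. 1 / (Delta m \<phi>)^3)"
    by (rule has_integral_unique)
  then show ?thesis
    using m by (simp add: field_simps)
qed

text \<open>Differentiation under the integral sign on the open ray \<open>m < 1\<close>. The ray
  contains 0, so \<open>ell_ratio\<close> is also continuous there, where the intermediate value
  arguments start.\<close>

lemma ellE_derivative_integral:
  assumes m: "m < 1"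
  shows "(ellE has_field_derivative integral {0..2*pi} (\<lambda>\<phi>. - ((sin \<phi>)^2 / (2 * Delta m \<phi>)))) (at m)"
proof -
  have "((\<lambda>m. integral (cbox 0 (2*pi)) (Delta m)) has_field_derivative
      integral (cbox 0 (2*pi)) (\<lambda>\<phi>. - ((sin \<phi>)^2 / (2 * Delta m \<phi>)))) (at m within {..<1})"
  proof (rule leibniz_rule_field_derivative)
    show "continuous_on ({..<1} \<times> cbox 0 (2*pi)) (\<lambda>(x, t). - ((sin t)^2 / (2 * Delta x t)))"
      unfolding split_beta
      by (intro continuous_intros ballI) (use Delta_pos in \<open>simp add: mem_Times_iff less_imp_neq[symmetric]\<close>)
  qed (use m integrable_ell in \<open>simp_all add: DERIV_Delta_param\<close>)
  then show ?thesis
    using m by (simp add: ellE_def[abs_def] at_within_open[of m "{..<1}"])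
qed

lemma ellK_derivative_integral:
  assumes m: "m < 1"
  shows "(ellK has_field_derivative integral {0..2*pi} (\<lambda>\<phi>. (sin \<phi>)^2 / (2 * (Delta m \<phi>)^3))) (at m)"
proof -
  have der: "((\<lambda>m. 1 / Delta m \<phi>) has_field_derivative (sin \<phi>)^2 / (2 * (Delta m \<phi>)^3)) (at m within S)"
    if "m < 1" for m \<phi> S
    using Delta_pos[OF that, of \<phi>]
    by (intro DERIV_cong[OF DERIV_divide[OF DERIV_const DERIV_Delta_param[OF that]]])
      (simp_all add: power3_eq_cube mult_ac)
  have "((\<lambda>m. integral (cbox 0 (2*pi)) (\<lambda>\<phi>. 1 / Delta m \<phi>)) has_field_derivative
      integral (cbox 0 (2*pi)) (\<lambda>\<phi>. (sin \<phi>)^2 / (2 * (Delta m \<phi>)^3))) (at m within {..<1})"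
  proof (rule leibniz_rule_field_derivative)
    show "continuous_on ({..<1} \<times> cbox 0 (2*pi)) (\<lambda>(x, t). (sin t)^2 / (2 * (Delta x t)^3))"
      unfolding split_beta
      by (intro continuous_intros ballI) (use Delta_pos in \<open>simp add: mem_Times_iff less_imp_neq[symmetric]\<close>)
  qed (use m integrable_ell in \<open>simp_all add: der\<close>)
  then show ?thesis
    using m by (simp add: ellK_def[abs_def] at_within_open[of m "{..<1}"])
qed

text \<open>Replacing \<open>sin^2\<close> by \<open>(1 - Delta^2) / m\<close> reduces the
  differentiated integrand to \<open>Delta\<close> and \<open>1 / Delta\<close>.\<close>

lemma DERIV_ellE:
  assumes m: "0 < m" "m < 1"
  shows "(ellE has_field_derivative (ellE m - ellK m) / (2 * m)) (at m)"
proof -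
  have "- ((sin \<phi>)^2 / (2 * Delta m \<phi>)) = (Delta m \<phi> - 1 / Delta m \<phi>) / (2 * m)" for \<phi>
  proof -
    have "(sin \<phi>)^2 = (1 - (Delta m \<phi>)^2) / m"
      using Delta_sq[OF m(2), of \<phi>] m by (simp add: field_simps)
    then show ?thesis
      using Delta_pos[OF m(2), of \<phi>] m
      by (simp add: field_simps power2_eq_square power3_eq_cube)
  qed
  then have "integral {0..2*pi} (\<lambda>\<phi>. - ((sin \<phi>)^2 / (2 * Delta m \<phi>))) =
      integral {0..2*pi} (\<lambda>\<phi>. Delta m \<phi> - 1 / Delta m \<phi>) / (2 * m)"
    by simp
  also have "\<dots> = (ellE m - ellK m) / (2 * m)"
    using integrable_ell[OF m(2)]
    by (subst Henstock_Kurzweil_Integration.integral_diff) (auto simp: ellE_def ellK_def)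
  finally show ?thesis
    using ellE_derivative_integral[OF m(2)] by simp
qed

text \<open>The same substitution leaves \<open>1 / Delta^3\<close>, whose integral is known in
  terms of \<open>ellE\<close>.\<close>

lemma DERIV_ellK:
  assumes m: "0 < m" "m < 1"
  shows "(ellK has_field_derivative (ellE m / (1 - m) - ellK m) / (2 * m)) (at m)"
proof -
  have "(sin \<phi>)^2 / (2 * (Delta m \<phi>)^3) = (1 / (Delta m \<phi>)^3 - 1 / Delta m \<phi>) / (2 * m)" for \<phi>
  proof -
    have "(sin \<phi>)^2 = (1 - (Delta m \<phi>)^2) / m"
      using Delta_sq[OF m(2), of \<phi>] m by (simp add: field_simps)
    moreover have "1 / Delta m \<phi> = (Delta m \<phi>)^2 / (Delta m \<phi>)^3"
      using Delta_pos[OF m(2), of \<phi>] by (simp add: power2_eq_square power3_eq_cube)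
    ultimately show ?thesis
      by (simp only: diff_divide_distrib[symmetric] divide_divide_eq_left mult_ac)
  qed
  then have "integral {0..2*pi} (\<lambda>\<phi>. (sin \<phi>)^2 / (2 * (Delta m \<phi>)^3)) =
      integral {0..2*pi} (\<lambda>\<phi>. 1 / (Delta m \<phi>)^3 - 1 / Delta m \<phi>) / (2 * m)"
    by simp
  also have "\<dots> = (ellE m / (1 - m) - ellK m) / (2 * m)"
    using integrable_ell[OF m(2)]
    by (subst Henstock_Kurzweil_Integration.integral_diff) (auto simp: integral_inverse_Delta_cube[OF m(2)] ellK_def)
  finally show ?thesis
    using ellK_derivative_integral[OF m(2)] by simp
qed

lemma ellK_pos: 
  assumes "0 \<le> m" "m < 1"
  shows "0 < ellK m"
proof -
  have "integral {0..2*pi} (\<lambda>\<phi>. 1 :: real) \<le> ellK m"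
    unfolding ellK_def
  proof (rule integral_le)
    show "1 \<le> 1 / Delta m \<phi>" for \<phi>
      using Delta_pos[OF assms(2), of \<phi>] assms(1) by (simp add: divide_simps) (simp add: Delta_def)
  qed (use integrable_ell[OF assms(2)] in auto)
  then have "2 * pi \<le> ellK m"
    by simp
  then show ?thesis
    using pi_gt_zero by linarith
qed

lemma ell_ratio_0: "ell_ratio 0 = 1"
proof -
  have "Delta 0 = (\<lambda>\<phi>. 1)"
    by (simp add: Delta_def fun_eq_iff)
  then show ?thesis
    using pi_neq_zero by (simp add: ell_ratio_def ellE_def ellK_def)
qed

lemma continuous_on_ell_ratio: "continuous_on {0..<1} ell_ratio"
proof -
  have "continuous_on {0..<1} ellE" "continuous_on {0..<1} ellK"
    using DERIV_isCont[OF ellE_derivative_integral] DERIV_isCont[OF ellK_derivative_integral]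
    by (simp_all add: continuous_at_imp_continuous_on)
  then show ?thesis
    unfolding ell_ratio_def[abs_def] 
    by (intro continuous_intros) (use ellK_pos in force)+
qed

text \<open>The logarithmic derivatives of the complete elliptic integrals combine into a Riccati equation.\<close>

lemma DERIV_ell_ratio:
  assumes m: "0 < m" "m < 1"
  defines "q \<equiv> 1 - 2 * m"
  shows "(ell_ratio has_field_derivative - (1 + (ell_ratio m - q)^2 / (1 - q^2))) (at m)"
proof -
  define K E where "K = ellK m" and "E = ellE m"
  have K: "K > 0"
    using ellK_pos[of m] m by (simp add: K_def)
  have K0: "ellK m \<noteq> 0"
    using K by (simp add: K_def)
  have "(ell_ratio has_field_derivative
      ((2 * ((E - K) / (2 * m))) * K - (2 * E) * ((E / (1 - m) - K) / (2 * m))) / (K * K) - 0) (at m)"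
    unfolding ell_ratio_def[abs_def] K_def E_def
    by (rule DERIV_diff[OF DERIV_divide[OF DERIV_cmult[OF DERIV_ellE[OF m]] DERIV_ellK[OF m] K0] DERIV_const])
  also have "((2 * ((E - K) / (2 * m))) * K - (2 * E) * ((E / (1 - m) - K) / (2 * m))) / (K * K) - 0
      = - (m * (1 - m) * K^2 + (E - (1 - m) * K)^2) / (m * (1 - m) * K^2)"
  proof -
    have "2 * ((E - K) / (2 * m)) = (E - K) * (1 - m) / (m * (1 - m))"
      "(2 * E) * ((E / (1 - m) - K) / (2 * m)) = E * (E - (1 - m) * K) / (m * (1 - m))"
      using m by (simp_all add: divide_simps)
    then have "((2 * ((E - K) / (2 * m))) * K - (2 * E) * ((E / (1 - m) - K) / (2 * m))) / (K * K) - 0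
      = ((E - K) * (1 - m) * K - E * (E - (1 - m) * K)) / (m * (1 - m) * K^2)"
    proof -
      have combine: "(p / M * K - r / M) / (K * K) - 0 = (p * K - r) / (M * K^2)" for p r M
        by (simp add: diff_divide_distrib power2_eq_square)
      assume "2 * ((E - K) / (2 * m)) = (E - K) * (1 - m) / (m * (1 - m))"
        "(2 * E) * ((E / (1 - m) - K) / (2 * m)) = E * (E - (1 - m) * K) / (m * (1 - m))"
      then show ?thesis
        by (simp only: combine)
    qed
    also have "(E - K) * (1 - m) * K - E * (E - (1 - m) * K) = - (m * (1 - m) * K^2 + (E - (1 - m) * K)^2)"
      by (simp add: power2_eq_square algebra_simps)
    finally show ?thesis .
  qed
  also have "\<dots> = - (1 + (ell_ratio m - q)^2 / (1 - q^2))"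
  proof -
    have "1 - q^2 = 4 * (m * (1 - m))"
      by (simp add: q_def power2_eq_square algebra_simps)
    moreover have "ell_ratio m - q = 2 * (E - (1 - m) * K) / K"
      using K by (simp add: ell_ratio_def E_def K_def q_def field_simps)
    moreover have "(2 * X / K)^2 / (4 * N) = X^2 / (N * K^2)" for X N
      by (simp add: power_divide power_mult_distrib)
    ultimately have "(ell_ratio m - q)^2 / (1 - q^2) = (E - (1 - m) * K)^2 / (m * (1 - m) * K^2)"
      by (simp only:)
    moreover have "- (N + Q) / N = - (1 + Q / N)" if "N \<noteq> 0" for N Q :: real
      using that by (simp add: diff_divide_distrib)
    ultimately show ?thesis
      using K m by simp
  qed
  finally show ?thesis .
qed

text \<open>The right side of the Riccati equation is at most -1, since \<open>1 - q^2\<close> is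
  positive for \<open>0 < m < 1\<close>.\<close>

lemma ell_ratio_strict_antimono:
  assumes "0 \<le> m" "m < m'" "m' < 1"
  shows "ell_ratio m' < ell_ratio m"
proof (rule DERIV_neg_imp_decreasing_open[OF assms(2)])
  fix x assume x: "m < x" "x < m'"
  then have "(1 - 2 * x)^2 < 1"
    using assms by (intro abs_square_less_1[THEN iffD2]) auto
  then have "- (1 + (ell_ratio x - (1 - 2 * x))^2 / (1 - (1 - 2 * x)^2)) < 0"
    by (smt (verit) divide_nonneg_pos zero_le_power2)
  then show "\<exists>y. DERIV ell_ratio x :> y \<and> y < 0"
    using DERIV_ell_ratio[of x] x assms by (auto intro!: exI)
next
  show "continuous_on {m..m'} ell_ratio"
    using assms by (auto intro: continuous_on_subset[OF continuous_on_ell_ratio])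
qed

lemma ell_ratio_less_1:
  assumes "0 < m" "m < 1"
  shows "ell_ratio m < 1"
  using ell_ratio_strict_antimono[OF order.refl assms] by (simp add: ell_ratio_0)

lemma ell_ratio_mvt:
  assumes "0 \<le> a" "a < b" "b < 1"
  obtains x where "a < x" "x < b"
    "ell_ratio b - ell_ratio a = - (b - a) * (1 + (ell_ratio x - (1 - 2 * x))^2 / (1 - (1 - 2 * x)^2))"
proof -
  have "continuous_on {a..b} ell_ratio"
    using assms by (auto intro: continuous_on_subset[OF continuous_on_ell_ratio])
  moreover have "ell_ratio differentiable at x" if "a < x" "x < b" for x
    using DERIV_ell_ratio[of x] that assms by (auto simp: real_differentiable_def)
  ultimately obtain l x where x: "a < x" "x < b" "DERIV ell_ratio x :> l" "ell_ratio b - ell_ratio a = (b - a) * l"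
    using MVT[OF assms(2)] by blast
  moreover have "l = - (1 + (ell_ratio x - (1 - 2 * x))^2 / (1 - (1 - 2 * x)^2))"
    using DERIV_unique[OF x(3) DERIV_ell_ratio] x assms by auto
  ultimately show thesis
    using that[of x] by (simp only: mult_minus_right mult_minus_left)
qed

text \<open>Slope at most -1 brings the ratio from 1 down to at most 1/4 at 3/4. If it stayed
  nonnegative up to 99/100, the quadratic Riccati term would be at least (1/4)/(3/4) = 1/3 from
  there on, forcing a further drop of 8/25, which exceeds 1/4.\<close>

lemma ell_ratio_negative: "ell_ratio (99 / 100) < 0"
proof (rule ccontr)
  assume neg: "\<not> ell_ratio (99 / 100) < 0"
  obtain x where x: "0 < x" "x < 3 / 4" "ell_ratio (3 / 4) - ell_ratio 0 =
      - (3 / 4 - 0) * (1 + (ell_ratio x - (1 - 2 * x))^2 / (1 - (1 - 2 * x)^2))"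
    by (rule ell_ratio_mvt[of 0 "3 / 4"]) auto
  have "(1 - 2 * x)^2 \<le> 1"
    using x by (simp add: abs_square_le_1)
  then have "0 \<le> (ell_ratio x - (1 - 2 * x))^2 / (1 - (1 - 2 * x)^2)"
    by simp
  moreover have "- (3 / 4 - 0) * (1 + z) \<le> - 3 / 4" if "0 \<le> z" for z :: real
    using that by simp
  ultimately have "ell_ratio (3 / 4) - ell_ratio 0 \<le> - 3 / 4"
    unfolding x(3) by blast
  then have le: "ell_ratio (3 / 4) \<le> 1 / 4"
    by (simp add: ell_ratio_0)
  obtain y where y: "3 / 4 < y" "y < 99 / 100" "ell_ratio (99 / 100) - ell_ratio (3 / 4) =
      - (99 / 100 - 3 / 4) * (1 + (ell_ratio y - (1 - 2 * y))^2 / (1 - (1 - 2 * y)^2))"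
    by (rule ell_ratio_mvt[of "3 / 4" "99 / 100"]) auto
  have "0 \<le> ell_ratio y"
    using ell_ratio_strict_antimono[of y "99 / 100"] y neg by simp
  then have "(1 / 2)^2 \<le> (ell_ratio y - (1 - 2 * y))^2"
    using y by (intro power_mono) auto
  moreover have "(1 / 2)^2 \<le> (2 * y - 1)^2"
    using y by (intro power_mono) auto
  moreover have "(2 * y - 1)^2 < 1"
    using y by (simp add: abs_square_less_1)
  ultimately have "1 / 3 \<le> (ell_ratio y - (1 - 2 * y))^2 / (1 - (1 - 2 * y)^2)"
    by (simp add: divide_simps power2_commute[of 1] power2_eq_square[of 2])
  moreover have "- (99 / 100 - 3 / 4) * (1 + z) \<le> - 8 / 25" if "1 / 3 \<le> z" for z :: real
    using that by simp
  ultimately have "ell_ratio (99 / 100) - ell_ratio (3 / 4) \<le> - 8 / 25"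
    unfolding y(3) by blast
  then show False
    using le neg by simp
qed

lemma ell_ratio_surj:
  assumes "0 < y" "y < 1"
  obtains m where "0 < m" "m < 1" "ell_ratio m = y"
proof -
  have "\<exists>x\<ge>0. x \<le> 99 / 100 \<and> ell_ratio x = y"
    using assms ell_ratio_negative
    by (intro IVT2') (auto simp: ell_ratio_0 intro: continuous_on_subset[OF continuous_on_ell_ratio])
  then obtain x where "0 \<le> x" "x \<le> 99 / 100" "ell_ratio x = y" by blast
  then show thesis
    using that[of x] assms ell_ratio_0 by (cases "x = 0") auto
qed

subsection \<open>Explicit solution of the scalar equation\<close>

text \<open>The increment of an antiderivative over one period has derivative zero, hence equals the
  integral over a period. This serves both the clock and the drift of \<open>y\<close>.\<close>

lemma periodic_antiderivative:
  fixes f :: "real \<Rightarrow> real"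
  assumes cont: "continuous_on UNIV f" and per: "\<And>x. f (x + 2 * pi) = f x"
  obtains F where "\<And>x. (F has_field_derivative f x) (at x)"
    "\<And>x. F (x + 2 * pi) = F x + integral {0..2*pi} f"
proof -
  have "\<exists>F. \<forall>x::real. - \<infinity> < ereal x \<longrightarrow> ereal x < \<infinity> \<longrightarrow> (F has_vector_derivative f x) (at x)"
    using cont by (intro einterval_antiderivative) (auto simp: continuous_on_eq_continuous_at)
  then obtain F where F: "\<And>x. (F has_field_derivative f x) (at x)"
    by (auto simp: has_real_derivative_iff_has_vector_derivative)
  have "((\<lambda>x. F (x + 2 * pi) - F x) has_field_derivative 0) (at x)" for x
    using DERIV_diff[OF DERIV_shift[THEN iffD1, OF F[of "x + 2 * pi"]] F[of x]] per by simp
  then have "F (x + 2 * pi) - F x = F (0 + 2 * pi) - F 0" for x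
    using DERIV_isconst_all by blast
  moreover have "(f has_integral F (2 * pi) - F 0) {0..2*pi}"
    using F by (intro fundamental_theorem_of_calculus)
      (auto simp: has_real_derivative_iff_has_vector_derivative[symmetric] intro: has_field_derivative_at_within)
  ultimately have "F (x + 2 * pi) = F x + integral {0..2*pi} f" for x
    by (simp add: integral_unique algebra_simps)
  with F show thesis by (rule that)
qed

text \<open>Iterating the translation pushes the values past every bound in both directions. This
  makes the inverse of the time function defined at all times.\<close>

lemma translation_equivariant_surj:
  fixes F :: "real \<Rightarrow> real"
  assumes cont: "continuous_on UNIV F" and p: "p > 0" and \<omega>: "\<omega> > 0"
    and per: "\<And>x. F (x + p) = F x + \<omega>"
  shows "surj F"
proof -
  have up: "F (real n * p) = F 0 + real n * \<omega>" for n
  proof (induction n)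
    case (Suc n)
    then show ?case using per[of "real n * p"] by (simp add: algebra_simps)
  qed simp
  have down: "F (- (real n * p)) = F 0 - real n * \<omega>" for n
  proof (induction n)
    case (Suc n)
    then show ?case using per[of "- (real (Suc n) * p)"] by (simp add: algebra_simps)
  qed simp
  have "\<exists>x. F x = y" for y
  proof -
    obtain n :: nat where n: "\<bar>y - F 0\<bar> < real n * \<omega>"
      using reals_Archimedean3[OF \<omega>] by blast
    have "- (real n * p) \<le> real n * p"
      using p by simp
    moreover have "F (- (real n * p)) \<le> y" "y \<le> F (real n * p)"
      using n up[of n] down[of n] by (auto simp: abs_if split: if_splits)
    ultimately show ?thesis
      using IVT'[of F "- (real n * p)" y "real n * p"] continuous_on_subset[OF cont] by blast
  qed
  then show ?thesis
    by (metis surjI)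
qed

text \<open>The autonomous equation \<open>\<psi>' = w(\<psi>)\<close> is solved by inverting the time \<open>\<integral> d\<psi> / w\<close>.\<close>

lemma periodic_clock:
  fixes w :: "real \<Rightarrow> real"
  assumes cont: "continuous_on UNIV w" and pos: "\<And>x. 0 < w x" and per: "\<And>x. w (x + 2 * pi) = w x"
  obtains \<psi> \<omega> where "\<omega> > 0" "\<And>t. (\<psi> has_field_derivative w (\<psi> t)) (at t)"
    "\<And>t. \<psi> (t + \<omega>) = \<psi> t + 2 * pi" "surj \<psi>"
proof -
  define \<omega> where "\<omega> = integral {0..2*pi} (\<lambda>x. 1 / w x)"
  have nz: "w x \<noteq> 0" for x
    using pos[of x] by simp
  have "continuous_on UNIV (\<lambda>x. 1 / w x)"
    using nz by (intro continuous_intros cont) auto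
  then obtain T where T: "\<And>x. (T has_field_derivative 1 / w x) (at x)" "\<And>x. T (x + 2 * pi) = T x + \<omega>"
    using periodic_antiderivative[of "\<lambda>x. 1 / w x"] per unfolding \<omega>_def by auto
  have mono: "T x < T y" if "x < y" for x y
    by (rule DERIV_pos_imp_increasing[OF that]) (use T(1) pos in \<open>auto intro!: exI\<close>)
  have \<omega>: "\<omega> > 0"
    using mono[of 0 "0 + 2 * pi"] T(2)[of 0] pi_gt_zero by simp
  have contT: "isCont T x" for x
    using T(1) by (rule DERIV_isCont)
  have "surj T"
    using contT pi_gt_zero \<omega> T(2)
    by (intro translation_equivariant_surj[of T "2 * pi" \<omega>]) (auto simp: continuous_on_eq_continuous_at)
  moreover have inj: "inj T"
    using mono by (metis injI less_irrefl linorder_neqE_linordered_idom)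
  ultimately have TV: "T (inv T t) = t" and VT: "inv T (T x) = x" for t x
    by (simp_all add: surj_f_inv_f)
  define \<psi> where "\<psi> = inv T"
  have "isCont \<psi> t" for t
    using isCont_inverse_function[of 1 "\<psi> t" \<psi> T] contT VT TV by (simp add: \<psi>_def)
  then have "(\<psi> has_field_derivative inverse (1 / w (\<psi> t))) (at t)" for t
    using nz TV
    by (intro DERIV_inverse_function[where a = "t - 1" and b = "t + 1" and f = T]) (auto simp: \<psi>_def T(1))
  then have der: "(\<psi> has_field_derivative w (\<psi> t)) (at t)" for t
    by simp
  have "\<psi> (t + \<omega>) = \<psi> t + 2 * pi" for t
    unfolding \<psi>_def by (metis T(2) TV VT)
  moreover have "surj \<psi>"
    unfolding \<psi>_def by (metis VT surjI)
  ultimately show thesis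
    using \<omega> der that by blast
qed

text \<open>
  Here \<open>C = cos \<psi>\<close>, \<open>Q = S \<Delta>\<^sup>2\<close>, and \<open>(C + k) / n\<close> is the image of \<open>C\<close> under the Moebius map; the
  identities are the equation of motion, the primitive of \<open>\<beta>\<close> and the first integral,
  cleared of denominators.
\<close>

lemma moebius_identities:
  fixes d r k S C :: real
  assumes R1: "d * r * (1 + k^2) + k * (1 + r^2) = 0"
    and R2: "S * (1 - k^2) = (1 + k^2) * (1 + r^2) + 4 * d * r * k"
    and X: "X = 1 + r^2 - 2 * d^2"
    and T: "T = X + (S - X) * C^2" and Q: "2 * Q = S + X + (S - X) * C^2" and n: "n = 1 + k * C"
    and b: "b = (1 - 2 * d^2) * n^2 + 2 * d^2 * (C + k)^2 + 2 * d * r * (C + k) * n"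
  shows "- 2 * d * (1 - k^2) * (C * T * n + 2 * k * (1 - C^2) * Q) = r * n^3 - b * (r * n + 2 * d * (C + k))"
    and "(1 - k^2) * (- 2 * k * (C * T * n + k * (1 - C^2) * Q)) = (1 - k^2) * (b + r^2 * n^2 - T * n^2)"
    and "(1 - k^2) * Q = (d * (C + k) + r * n)^2 + (1 - d^2) * n^2"
  using assms by algebra+

text \<open>The factor \<open>S\<close>: after the Moebius substitution the factor of the quartic
  without real roots becomes a multiple of \<open>S * Delta^2\<close>.\<close>

definition quartic_scale :: "real \<Rightarrow> real \<Rightarrow> real" where
  "quartic_scale r d = sqrt ((1 + r^2)^2 - 4 * r^2 * d^2)"

text \<open>The parameter \<open>m\<close> (the square of the modulus \<open>k\<close>) of the elliptic integrals.\<close>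

definition modulus :: "real \<Rightarrow> real \<Rightarrow> real" where
  "modulus r d = (1 - (1 + r^2 - 2 * d^2) / quartic_scale r d) / 2"

text \<open>The equation c^2 (S g(m) - r^2) = 1 for the mean of \<beta>, divided by c^2, with r =
  \<rho> / c^3.\<close>

definition closing :: "real \<Rightarrow> real \<Rightarrow> real \<Rightarrow> bool" where
  "closing \<rho> c d \<longleftrightarrow>
     quartic_scale (\<rho> / c^3) d * ell_ratio (modulus (\<rho> / c^3) d) = (\<rho> / c^3)^2 + 1 / c^2"

text \<open>The radicand of \<open>S\<close> equals
  \<open>(1 - r^2)^2 + 4 * r^2 * (1 - d^2)\<close>, and \<open>S^2\<close> exceeds
  \<open>(1 + r^2 - 2 * d^2)^2\<close> by \<open>4 * d^2 * (1 - d^2)\<close>; the latter keeps the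
  parameter strictly between 0 and 1.\<close>

lemma
  assumes d: "0 < d" "d < 1"
  shows quartic_scale_pos: "0 < quartic_scale r d"
    and quartic_scale_sq: "(quartic_scale r d)^2 = (1 + r^2)^2 - 4 * r^2 * d^2"
    and modulus_eq: "2 * quartic_scale r d * modulus r d = quartic_scale r d - (1 + r^2 - 2 * d^2)"
    and modulus_bounds: "0 < modulus r d" "modulus r d < 1"
proof -
  have d2: "d^2 < 1" "0 < d^2"
    using d by (simp_all add: abs_square_less_1)
  have "0 < (1 - r^2)^2 + 4 * r^2 * (1 - d^2)"
  proof (cases "r = 0")
    case False
    then show ?thesis
      using d2 by (intro add_nonneg_pos) auto
  qed simp
  also have "\<dots> = (1 + r^2)^2 - 4 * r^2 * d^2"
    by algebra
  finally have pos: "0 < (1 + r^2)^2 - 4 * r^2 * d^2" .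
  then show S: "0 < quartic_scale r d"
    by (simp add: quartic_scale_def)
  show sq: "(quartic_scale r d)^2 = (1 + r^2)^2 - 4 * r^2 * d^2"
    using pos by (simp add: quartic_scale_def)
  show m: "2 * quartic_scale r d * modulus r d = quartic_scale r d - (1 + r^2 - 2 * d^2)"
    using S by (simp add: modulus_def field_simps)
  have "(1 + r^2 - 2 * d^2)^2 = (quartic_scale r d)^2 - 4 * (d^2 * (1 - d^2))"
    unfolding sq by algebra
  also have "\<dots> < (quartic_scale r d)^2"
    using d2 by simp
  finally have "\<bar>1 + r^2 - 2 * d^2\<bar> < quartic_scale r d"
    using S power2_less_imp_less[of "\<bar>1 + r^2 - 2 * d^2\<bar>" "quartic_scale r d"] by simp
  then have "\<bar>(1 + r^2 - 2 * d^2) / quartic_scale r d\<bar> < 1"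
    using S by simp
  then show "0 < modulus r d" "modulus r d < 1"
    unfolding modulus_def by (simp_all only: abs_less_iff) auto
qed

text \<open>The first equation is a quadratic in \<open>k\<close> that kills the linear term in
  \<open>C\<close> of the transformed quartic factor. Its roots are reciprocal; \<open>k\<close> is
  the one inside the unit interval, rationalised so that \<open>r = 0\<close> is covered.\<close>

lemma moebius_parameter:
  fixes d r :: real
  assumes d: "0 < d" "d < 1"
  defines "k \<equiv> - 2 * d * r / (1 + r^2 + quartic_scale r d)"
  shows "d * r * (1 + k^2) + k * (1 + r^2) = 0"
    and "quartic_scale r d * (1 - k^2) = (1 + k^2) * (1 + r^2) + 4 * d * r * k"
    and "k^2 < 1"
proof -
  define S where "S = quartic_scale r d"
  have S: "S > 0" "S^2 = (1 + r^2)^2 - 4 * r^2 * d^2"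
    using quartic_scale_pos[OF d] quartic_scale_sq[OF d] by (simp_all add: S_def)
  have N: "0 < 1 + r^2 + S"
    using S(1) zero_le_power2[of r] by linarith
  then have N0: "1 + r^2 + S \<noteq> 0" by simp
  have k: "k * (1 + r^2 + S) = - 2 * d * r"
    using N0 by (simp add: k_def S_def)
  have "(1 + r^2 + S)^2 * (d * r * (1 + k^2) + k * (1 + r^2)) = 0"
    using k S(2) by algebra
  then show R1: "d * r * (1 + k^2) + k * (1 + r^2) = 0"
    using N0 by simp
  have "(1 + r^2 + S)^2 * (S * (1 - k^2) - ((1 + k^2) * (1 + r^2) + 4 * d * r * k)) = 0"
    using k S(2) by algebra
  then show "quartic_scale r d * (1 - k^2) = (1 + k^2) * (1 + r^2) + 4 * d * r * k"
    using N0 by (simp add: S_def)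
  have "(d * r)^2 \<le> r^2"
    using d by (simp add: power_mult_distrib mult_left_le_one_le abs_square_le_1)
  moreover have "4 * r^2 \<le> (1 + r^2)^2"
    using zero_le_power2[of "1 - r^2"] by (simp add: power2_eq_square algebra_simps)
  moreover have "(1 + r^2)^2 < (1 + r^2 + S)^2"
    using S(1) by (intro power_strict_mono) auto
  ultimately have "(2 * d * r)^2 < (1 + r^2 + S)^2"
    by (simp add: power_mult_distrib)
  then show "k^2 < 1"
    using N by (simp add: k_def S_def power_divide power_mult_distrib)
qed

text \<open>\<open>\<omega>\<close> is a period of the profile and \<open>\<delta>\<close> the drift
  of the second coordinate over it.\<close>

definition periodic_profile ::
  "real \<Rightarrow> real \<Rightarrow> (real \<Rightarrow> real) \<Rightarrow> (real \<Rightarrow> real) \<Rightarrow> (real \<Rightarrow> real) \<Rightarrow> real \<Rightarrow> real \<Rightarrow> bool" where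
  "periodic_profile \<rho> K U A Y \<omega> \<delta> \<longleftrightarrow> \<omega> > 0 \<and> magnetic_profile \<rho> K U A \<and>
     (\<forall>t. (Y has_field_derivative (U t)^2 / 2 + K - 1) (at t)) \<and>
     (\<forall>t. U (t + \<omega>) = U t \<and> A (t + \<omega>) = A t \<and> Y (t + \<omega>) = Y t + \<delta>)"

text \<open>The profile is an explicit function of an angle that advances at rate
  \<open>c * sqrt S * Delta\<close>, and the drift is then a combination of \<open>ellE\<close> and
  \<open>ellK\<close>. One profile passes through the starting points for all \<open>e\<close>,
  which is why the closing condition does not involve \<open>e\<close>.\<close>

lemma periodic_profile_exists:
  fixes \<rho> c d :: real
  assumes c: "0 < c" and d: "0 < d" "d < 1"
  obtains U A Y \<omega> \<delta> where
    "periodic_profile \<rho> (c^2 * (1 - 2 * d^2) - \<rho>^2 / (2 * c^4)) U A Y \<omega> \<delta>"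
    "\<delta> = 0 \<longleftrightarrow> closing \<rho> c d"
    "\<And>e. \<bar>e\<bar> \<le> 1 \<Longrightarrow> \<exists>t. U t = \<rho> / c^2 + 2 * c * d * e \<and> A t = x0 \<rho> c d e"
proof -
  define r where "r = \<rho> / c^3"
  have \<rho>: "\<rho> = c^3 * r"
    using c by (simp add: r_def)
  define S where "S = quartic_scale r d"
  define m where "m = modulus r d"
  define k where "k = - 2 * d * r / (1 + r^2 + S)"
  define X where "X = 1 + r^2 - 2 * d^2"
  define sS where "sS = sqrt S"
  have S: "S > 0" and m: "0 < m" "m < 1" and Sm: "2 * S * m = S - X"
    using quartic_scale_pos[OF d] modulus_bounds[OF d] modulus_eq[OF d]
    by (simp_all add: S_def m_def X_def)
  have sS: "sS > 0" "sS * sS = S"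
    using S by (simp_all add: sS_def)
  have R1: "d * r * (1 + k^2) + k * (1 + r^2) = 0"
    and R2: "S * (1 - k^2) = (1 + k^2) * (1 + r^2) + 4 * d * r * k" and k2: "k^2 < 1"
    using moebius_parameter[OF d, of r] by (simp_all add: k_def S_def)
  have k1: "\<bar>k\<bar> < 1"
    using k2 by (simp add: abs_square_less_1)
  define n where "n x = 1 + k * cos x" for x
  define Q where "Q x = Delta m x" for x
  define T where "T x = X + (S - X) * (cos x)^2" for x
  define P where "P x = sin x * (sS * Q x)" for x
  \<comment> \<open>\<open>E\<close> is the Moebius image of the cosine; \<open>b\<close>,
    \<open>Uh\<close>, \<open>Ah\<close> are \<beta>, \<open>U\<close>, \<open>A\<close> divided by
    \<open>c^2\<close>, \<open>c\<close>, \<open>c^2\<close>.\<close>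
  define E where "E x = (cos x + k) / n x" for x
  define b where "b x = 1 - 2 * d^2 + 2 * d^2 * (E x)^2 + 2 * d * r * E x" for x
  define Uh where "Uh x = r + 2 * d * E x" for x
  define Ah where "Ah x = - (2 * d * (1 - k^2)) * P x / (n x)^2" for x
  \<comment> \<open>Up to the clock rate, \<open>- 2 * k * V\<close> has derivative
    \<open>b + r^2 - T\<close>. Being periodic it adds no drift, so \<open>b\<close> may be replaced
    by \<open>T - r^2\<close> when integrated over a period.\<close>
  define V where "V x = P x / n x" for x
  have n: "n x > 0" for x
  proof -
    have "\<bar>k * cos x\<bar> \<le> \<bar>k\<bar> * 1"
      unfolding abs_mult by (intro mult_left_mono) auto
    then show ?thesis
      using k1 unfolding n_def by linarith
  qed
  have n0: "n x \<noteq> 0" for x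
    using n[of x] by simp
  have Q: "Q x > 0" for x
    using Delta_pos[OF m(2)] by (simp add: Q_def)
  have SQ2: "S * (Q x)^2 = (S + X) / 2 + (S - X) * (cos x)^2 / 2" for x
  proof -
    have "(Q x)^2 = 1 - m * (1 - (cos x)^2)"
      using Delta_sq[OF m(2), of x] by (simp add: Q_def sin_squared_eq)
    then have "S * (Q x)^2 = S - S * m * (1 - (cos x)^2)"
      by algebra
    also have "\<dots> = (S + X) / 2 + (S - X) * (cos x)^2 / 2"
    proof -
      have "S * m = (S - X) / 2"
        using Sm by simp
      show ?thesis
        unfolding \<open>S * m = (S - X) / 2\<close> by (simp add: field_simps)
    qed
    finally show ?thesis .
  qed
  have SQ2': "2 * (S * (Q x)^2) = S + X + (S - X) * (cos x)^2" for x
    using SQ2[of x] by simp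
  have TQ: "T x = S * (2 * (Q x)^2 - 1)" for x
    using SQ2'[of x] T_def[of x] by algebra
  have bn: "b x * (n x)^2 = (1 - 2 * d^2) * (n x)^2 + 2 * d^2 * (cos x + k)^2 + 2 * d * r * (cos x + k) * n x" for x
    using n0[of x] by (simp add: b_def E_def power_divide distrib_right power2_eq_square)
  note I = moebius_identities[OF R1 R2 X_def T_def _ n_def bn]
  have dn: "(n has_field_derivative - (k * sin x)) (at x)" for x
    unfolding n_def[abs_def] by (rule derivative_eq_intros refl | simp)+
  have dP: "(P has_field_derivative cos x * T x / (sS * Q x)) (at x)" for x
  proof -
    have "(P has_field_derivative cos x * (sS * Q x) + sin x * (sS * (- (m * sin x * cos x / Q x)))) (at x)"
      unfolding P_def[abs_def] Q_def[abs_def]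
      by (rule DERIV_cong[OF DERIV_mult[OF DERIV_sin DERIV_cmult[OF DERIV_Delta[OF m(2)]]]]) simp
    also have "cos x * (sS * Q x) + sin x * (sS * (- (m * sin x * cos x / Q x)))
        = cos x * (S * ((Q x)^2 - m * (sin x)^2)) / (sS * Q x)"
      using Q[of x] sS(1) unfolding sS(2)[symmetric] by (simp add: field_simps power2_eq_square)
    also have "S * ((Q x)^2 - m * (sin x)^2) = T x"
      using Delta_sq[OF m(2), of x] by (simp add: TQ Q_def)
    finally show ?thesis .
  qed
  have dE: "(E has_field_derivative - ((1 - k^2) * sin x / (n x)^2)) (at x)" for x
  proof -
    have "(E has_field_derivative ((- sin x) * n x - (cos x + k) * (- (k * sin x))) / (n x * n x)) (at x)"
      unfolding E_def[abs_def] by (rule DERIV_divide[OF _ dn n0]) (rule derivative_eq_intros refl | simp)+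
    also have "(- sin x) * n x - (cos x + k) * (- (k * sin x)) = - ((1 - k^2) * sin x)"
      by (simp add: n_def power2_eq_square algebra_simps)
    finally show ?thesis
      by (simp add: power2_eq_square)
  qed
  have dUh: "(Uh has_field_derivative 2 * d * - ((1 - k^2) * sin x / (n x)^2)) (at x)" for x
    unfolding Uh_def[abs_def] by (rule derivative_eq_intros dE refl | simp)+
  have dV: "(V has_field_derivative (cos x * T x / (sS * Q x) * n x + k * sin x * P x) / (n x)^2) (at x)" for x
    unfolding V_def[abs_def]
    by (rule DERIV_cong[OF DERIV_divide[OF dP dn n0]]) (simp add: power2_eq_square)
  have dAh: "(Ah has_field_derivative - (2 * d * (1 - k^2)) *
      ((cos x * T x / (sS * Q x) * n x + 2 * k * sin x * P x) / (n x)^3)) (at x)" for x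
  proof -
    have "((\<lambda>x. (n x)^2) has_field_derivative - (2 * n x * k * sin x)) (at x)"
      by (rule derivative_eq_intros dn refl | simp)+
    from DERIV_divide[OF DERIV_cmult[OF dP] this, of "- (2 * d * (1 - k^2))"] n0
    have "(Ah has_field_derivative (- (2 * d * (1 - k^2)) * (cos x * T x / (sS * Q x)) * (n x)^2 -
        - (2 * d * (1 - k^2)) * P x * (- (2 * n x * k * sin x))) / ((n x)^2 * (n x)^2)) (at x)"
      unfolding Ah_def[abs_def] by simp
    also have "(- (2 * d * (1 - k^2)) * p * (n x)^2 -
        - (2 * d * (1 - k^2)) * P x * (- (2 * n x * k * sin x))) / ((n x)^2 * (n x)^2)
      = - (2 * d * (1 - k^2)) * ((p * n x + 2 * k * sin x * P x) / (n x)^3)" for p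
    proof -
      have "- (2 * d * (1 - k^2)) * p * (n x)^2 - - (2 * d * (1 - k^2)) * P x * (- (2 * n x * k * sin x))
        = n x * (- (2 * d * (1 - k^2)) * (p * n x + 2 * k * sin x * P x))"
        by algebra
      moreover have "n x * z / ((n x)^2 * (n x)^2) = z / (n x)^3" for z
        using n0[of x] by (simp add: power2_eq_square power3_eq_cube)
      ultimately show ?thesis
        by (simp only: times_divide_eq_right)
    qed
    finally show ?thesis .
  qed
  have PQ: "sin x * P x * (sS * Q x) = (1 - (cos x)^2) * (S * (Q x)^2)" for x
  proof -
    have "sin x * P x * (sS * Q x) = (sin x)^2 * ((sS * sS) * (Q x)^2)"
      by (simp add: P_def power2_eq_square)
    then show ?thesis
      by (simp only: sS(2) sin_squared_eq)
  qed
  \<comment> \<open>The factor \<open>sS * Q x\<close>, which is the clock rate divided by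
    \<open>c\<close>, clears the inner denominator. \<open>j\<close> will be \<open>2 * k\<close>
    for \<open>Ah\<close> and \<open>k\<close> for \<open>V\<close>.\<close>
  have fac: "(cos x * T x / (sS * Q x) * n x + j * sin x * P x) * (sS * Q x)
      = cos x * T x * n x + j * (1 - (cos x)^2) * (S * (Q x)^2)" for x j
  proof -
    have "(cos x * T x / (sS * Q x) * n x + j * sin x * P x) * (sS * Q x)
      = cos x * T x * n x + j * (sin x * P x * (sS * Q x))"
      using Q[of x] sS(1) by (simp add: field_simps)
    then show ?thesis
      by (simp add: PQ)
  qed
  have Uh': "2 * d * - ((1 - k^2) * sin x / (n x)^2) * (sS * Q x) = Ah x" for x
    by (simp add: Ah_def P_def)
  have Ah': "- (2 * d * (1 - k^2)) * ((cos x * T x / (sS * Q x) * n x + 2 * k * sin x * P x) / (n x)^3) * (sS * Q x)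
      = r - b x * Uh x" for x
  proof -
    have "- (2 * d * (1 - k^2)) * ((cos x * T x / (sS * Q x) * n x + 2 * k * sin x * P x) / (n x)^3) * (sS * Q x)
      = - 2 * d * (1 - k^2) * ((cos x * T x / (sS * Q x) * n x + 2 * k * sin x * P x) * (sS * Q x)) / (n x)^3"
      by simp
    also have "\<dots> = (r * (n x)^3 - b x * (n x)^2 * (r * n x + 2 * d * (cos x + k))) / (n x)^3"
      unfolding fac using I(1)[OF SQ2'] by simp
    also have "r * (n x)^3 - b x * (n x)^2 * (r * n x + 2 * d * (cos x + k)) = (r - b x * Uh x) * (n x)^3"
    proof -
      have "cos x + k = E x * n x"
        using n0[of x] by (simp add: E_def)
      then show ?thesis
        unfolding Uh_def by algebra
    qed
    also have "(r - b x * Uh x) * (n x)^3 / (n x)^3 = r - b x * Uh x"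
      using n0[of x] by simp
    finally show ?thesis .
  qed
  have V': "- 2 * k * ((cos x * T x / (sS * Q x) * n x + k * sin x * P x) / (n x)^2) * (sS * Q x)
      = b x + r^2 - T x" for x
  proof -
    have "- 2 * k * ((cos x * T x / (sS * Q x) * n x + k * sin x * P x) / (n x)^2) * (sS * Q x)
      = - 2 * k * ((cos x * T x / (sS * Q x) * n x + k * sin x * P x) * (sS * Q x)) / (n x)^2"
      by simp
    also have "\<dots> = (b x * (n x)^2 + r^2 * (n x)^2 - T x * (n x)^2) / (n x)^2"
      unfolding fac using mult_left_cancel[THEN iffD1, OF _ I(2)[OF SQ2'[of x]]] k2 by simp
    also have "\<dots> = b x + r^2 - T x"
      using n0[of x] by (simp add: diff_divide_distrib add_divide_distrib)
    finally show ?thesis .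
  qed
  have bU: "b x = (Uh x)^2 / 2 + (1 - 2 * d^2) - r^2 / 2" for x
    by (simp add: b_def Uh_def power2_eq_square field_simps)
  have per: "n (x + 2 * pi) = n x" "Q (x + 2 * pi) = Q x" "T (x + 2 * pi) = T x" "P (x + 2 * pi) = P x"
     "Uh (x + 2 * pi) = Uh x" "Ah (x + 2 * pi) = Ah x" "V (x + 2 * pi) = V x" for x
    by (simp_all add: n_def Q_def T_def P_def Uh_def E_def Ah_def V_def Delta_periodic)
  \<comment> \<open>\<open>w\<close> is the angular speed; \<open>p\<close> is the derivative of
    \<open>Y\<close> less the exact part coming from \<open>V\<close>.\<close>
  define w where "w x = c * (sS * Q x)" for x
  define p where "p x = c^2 * (T x - r^2) - 1" for x
  have wpos: "0 < w x" for x
    using c sS(1) Q[of x] by (simp add: w_def)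
  have contQ: "continuous_on UNIV Q" and contT: "continuous_on UNIV T"
    unfolding Q_def[abs_def] T_def[abs_def] by (intro continuous_intros)+
  have perw: "w (x + 2 * pi) = w x" for x
    by (simp add: w_def per)
  have contw: "continuous_on UNIV w"
    unfolding w_def[abs_def] by (intro continuous_intros contQ)
  obtain \<psi> \<omega> where \<omega>: "\<omega> > 0" and \<psi>: "\<And>t. (\<psi> has_field_derivative w (\<psi> t)) (at t)"
    and \<psi>per: "\<And>t. \<psi> (t + \<omega>) = \<psi> t + 2 * pi" and surj: "surj \<psi>"
    by (rule periodic_clock[OF contw wpos perw]) (rule that)
  define \<delta> where "\<delta> = integral {0..2*pi} (\<lambda>x. p x / w x)"
  have wnz: "w x \<noteq> 0" for x
    using wpos[of x] by simp
  have contpw: "continuous_on UNIV (\<lambda>x. p x / w x)"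
    unfolding p_def by (intro continuous_intros contw contT) (use wnz in auto)
  have perpw: "p (x + 2 * pi) / w (x + 2 * pi) = p x / w x" for x
    by (simp add: p_def w_def per)
  obtain F where F: "\<And>x. (F has_field_derivative p x / w x) (at x)"
    and Fper: "\<And>x. F (x + 2 * pi) = F x + \<delta>"
    using periodic_antiderivative[OF contpw perpw] unfolding \<delta>_def by auto
  define U where "U t = c * Uh (\<psi> t)" for t
  define A where "A t = c^2 * Ah (\<psi> t)" for t
  define Y where "Y t = F (\<psi> t) + c * (- 2 * k * V (\<psi> t))" for t
  define K where "K = c^2 * (1 - 2 * d^2) - \<rho>^2 / (2 * c^4)"
  have K: "K = c^2 * ((1 - 2 * d^2) - r^2 / 2)"
    using c by (simp add: K_def \<rho> power_mult_distrib right_diff_distrib flip: power_mult)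
      (simp add: field_simps flip: power_add)
  have UK: "(U t)^2 / 2 + K = c^2 * b (\<psi> t)" for t
    by (simp add: U_def K bU power_mult_distrib distrib_left right_diff_distrib)
  have dU: "(U has_field_derivative A t) (at t)" for t
  proof -
    have "(U has_field_derivative c * (2 * d * - ((1 - k^2) * sin (\<psi> t) / (n (\<psi> t))^2) * w (\<psi> t))) (at t)"
      unfolding U_def[abs_def] by (rule DERIV_cmult[OF DERIV_chain2[OF dUh \<psi>]])
    also have "c * (z * w (\<psi> t)) = c^2 * (z * (sS * Q (\<psi> t)))" for z
      by (simp add: w_def power2_eq_square mult_ac)
    finally show ?thesis
      unfolding Uh' A_def .
  qed
  have dA: "(A has_field_derivative \<rho> - ((U t)^2 / 2 + K) * U t) (at t)" for t
  proof -
    let ?D = "\<lambda>x. - (2 * d * (1 - k^2)) * ((cos x * T x / (sS * Q x) * n x + 2 * k * sin x * P x) / (n x)^3)"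
    have "(A has_field_derivative c^2 * (?D (\<psi> t) * w (\<psi> t))) (at t)"
      unfolding A_def[abs_def] by (rule DERIV_cmult[OF DERIV_chain2[OF dAh \<psi>]])
    also have "c^2 * (?D (\<psi> t) * w (\<psi> t)) = c^3 * (?D (\<psi> t) * (sS * Q (\<psi> t)))"
      by (simp add: w_def power2_eq_square power3_eq_cube mult_ac)
    also have "\<dots> = \<rho> - ((U t)^2 / 2 + K) * U t"
      unfolding Ah' UK by (simp add: U_def \<rho> right_diff_distrib power2_eq_square power3_eq_cube)
    finally show ?thesis .
  qed
  have dY: "(Y has_field_derivative (U t)^2 / 2 + K - 1) (at t)" for t
  proof -
    let ?D = "\<lambda>x. (cos x * T x / (sS * Q x) * n x + k * sin x * P x) / (n x)^2"
    have "(Y has_field_derivative p (\<psi> t) / w (\<psi> t) * w (\<psi> t)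
        + c * (- 2 * k * (?D (\<psi> t) * w (\<psi> t)))) (at t)"
      unfolding Y_def[abs_def]
      by (rule DERIV_add[OF DERIV_chain2[OF F \<psi>] DERIV_cmult[OF DERIV_cmult[OF DERIV_chain2[OF dV \<psi>]]]])
    also have "p (\<psi> t) / w (\<psi> t) * w (\<psi> t) = p (\<psi> t)"
      using wnz by simp
    also have "c * (- 2 * k * (?D (\<psi> t) * w (\<psi> t))) = c^2 * (- 2 * k * ?D (\<psi> t) * (sS * Q (\<psi> t)))"
      by (simp add: w_def power2_eq_square mult_ac)
    also have "p (\<psi> t) + \<dots> = (U t)^2 / 2 + K - 1"
      unfolding V' UK by (simp add: p_def algebra_simps)
    finally show ?thesis .
  qed
  have \<delta>: "\<delta> = ellK m / (c * sS) * (c^2 * S * ell_ratio m - (c^2 * r^2 + 1))"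
  proof -
    \<comment> \<open>Since \<open>T = S * (2 * Delta^2 - 1)\<close>, only \<open>Delta\<close> and
      \<open>1 / Delta\<close> occur.\<close>
    have "p x / w x = (2 * c^2 * S * Delta m x - (c^2 * S + c^2 * r^2 + 1) * (1 / Delta m x)) / (c * sS)" for x
      using Q[of x] c sS(1)
      by (simp add: p_def w_def TQ Q_def) (simp add: field_simps power2_eq_square)
    then have "\<delta> = integral {0..2*pi} (\<lambda>x. (2 * c^2 * S * Delta m x - (c^2 * S + c^2 * r^2 + 1) * (1 / Delta m x)) / (c * sS))"
      by (simp add: \<delta>_def)
    also have "\<dots> = (2 * c^2 * S * ellE m - (c^2 * S + c^2 * r^2 + 1) * ellK m) / (c * sS)"
      unfolding ellE_def ellK_def using integrable_ell[OF m(2)]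
      by (intro integral_unique has_integral_divide has_integral_diff has_integral_mult_right integrable_integral)
    also have "2 * c^2 * S * ellE m = c^2 * S * (ell_ratio m + 1) * ellK m"
      using ellK_pos[of m] m by (simp add: ell_ratio_def)
    finally show ?thesis
      by (simp add: field_simps)
  qed
  have closing: "\<delta> = 0 \<longleftrightarrow> closing \<rho> c d"
  proof -
    have "\<delta> = 0 \<longleftrightarrow> c^2 * S * ell_ratio m = c^2 * r^2 + 1"
      using ellK_pos[of m] m c sS(1) by (simp add: \<delta>)
    also have "\<dots> \<longleftrightarrow> S * ell_ratio m = r^2 + 1 / c^2"
      using c by (simp add: field_simps)
    finally show ?thesis
      by (simp add: closing_def S_def m_def r_def)
  qed
  have start: "\<exists>t. U t = \<rho> / c^2 + 2 * c * d * e \<and> A t = x0 \<rho> c d e" if e: "\<bar>e\<bar> \<le> 1" for e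
  proof -
    \<comment> \<open>The inverse Moebius map applied to \<open>e\<close>.\<close>
    define C where "C = (e - k) / (1 - k * e)"
    \<comment> \<open>The sign makes \<open>sin x \<le> 0\<close>, hence \<open>A\<close>
      nonnegative like \<open>x0\<close>; the two can then be compared through their
      squares.\<close>
    define x where "x = - arccos C"
    have ke: "0 < 1 - k * e"
    proof -
      have "\<bar>k * e\<bar> \<le> \<bar>k\<bar> * 1"
        unfolding abs_mult using e by (intro mult_left_mono) auto
      then show ?thesis
        using k1 by linarith
    qed
    have "(1 - k) * (1 + e) \<ge> 0" "(1 + k) * (1 - e) \<ge> 0"
      using k1 e by (auto intro!: mult_nonneg_nonneg)
    then have C: "- 1 \<le> C" "C \<le> 1"
      using ke by (simp_all add: C_def divide_simps) (simp_all add: algebra_simps)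
    then have cosx: "cos x = C" and sinx: "sin x \<le> 0"
      using sin_ge_zero[OF arccos_lbound arccos_ubound, of C] by (simp_all add: x_def)
    have nx: "n x * (1 - k * e) = 1 - k^2"
      using ke by (simp add: n_def cosx C_def power2_eq_square distrib_right) (simp add: algebra_simps)
    have "C * (1 - k * e) = e - k"
      using ke by (simp add: C_def)
    then have "cos x + k = e * n x"
      unfolding n_def cosx by algebra
    then have Ex: "E x = e"
      using n0[of x] by (simp add: E_def)
    have ck: "cos x + k = e * n x" by fact
    obtain t where t: "\<psi> t = x"
      using surj by (metis surj_def)
    have "U t = \<rho> / c^2 + 2 * c * d * e"
      using c by (simp add: U_def t Uh_def Ex \<rho> power2_eq_square power3_eq_cube algebra_simps)
    moreover have "A t = x0 \<rho> c d e"
    proof (rule power2_eq_imp_eq)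
      have "P x \<le> 0"
        unfolding P_def using sinx Q[of x] sS(1) by (simp add: mult_nonpos_nonneg)
      then have "Ah x \<ge> 0"
        unfolding Ah_def using d k2 by (intro divide_nonneg_nonneg mult_nonpos_nonpos) auto
      then show "0 \<le> A t"
        by (simp add: A_def t)
      have d2: "d^2 \<le> 1" and e2: "e^2 \<le> 1"
        using d e by (simp_all add: abs_square_le_1)
      show "0 \<le> x0 \<rho> c d e"
        using c d d2 e2 by (simp add: x0_def)
      have x0sq: "(x0 \<rho> c d e)^2 = 4 * d^2 / c^2 * (1 - e^2) * ((c^3 * d * e + \<rho>)^2 + (1 - d^2) * c^6)"
        using c d2 e2 by (simp add: x0_def power_mult_distrib power_divide)
      have "(P x)^2 = (1 - (cos x)^2) * (S * (Q x)^2)"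
        by (simp add: P_def power_mult_distrib sin_squared_eq sS(2)[symmetric] power2_eq_square[of sS])
      then have "(Ah x)^2 = 4 * d^2 * ((1 - k^2) * (1 - (cos x)^2)) * ((1 - k^2) * (S * (Q x)^2)) / (n x)^4"
        by (simp add: Ah_def power_mult_distrib power_divide flip: power_mult) (simp add: power2_eq_square mult_ac)
      also have "(1 - k^2) * (S * (Q x)^2) = (n x)^2 * ((d * e + r)^2 + (1 - d^2))"
        unfolding I(3)[OF SQ2'] ck by algebra
      also have "(1 - k^2) * (1 - (cos x)^2) = (n x)^2 * (1 - e^2)"
        using ck n_def[of x] by algebra
      also have "4 * d^2 * ((n x)^2 * (1 - e^2)) * ((n x)^2 * ((d * e + r)^2 + (1 - d^2))) / (n x)^4
          = 4 * d^2 * (1 - e^2) * ((d * e + r)^2 + (1 - d^2))"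
        using n0[of x] by (simp add: power4_eq_xxxx power2_eq_square)
      finally have "(A t)^2 = c^4 * (4 * d^2 * (1 - e^2) * ((d * e + r)^2 + (1 - d^2)))"
        by (simp add: A_def t power_mult_distrib flip: power_mult)
      also have "\<dots> = (x0 \<rho> c d e)^2"
      proof -
        have eq1: "(c^3 * d * e + \<rho>)^2 + (1 - d^2) * c^6 = c^2 * (c^4 * ((d * e + r)^2 + (1 - d^2)))"
          unfolding \<rho> by algebra
        have eq2: "4 * d^2 / c^2 * (1 - e^2) * (c^2 * Z) = 4 * d^2 * (1 - e^2) * Z" for Z
          using c by simp
        show ?thesis
          unfolding x0sq eq1 eq2 by simp
      qed
      finally show "(A t)^2 = (x0 \<rho> c d e)^2" .
    qed
    ultimately show ?thesis by blast
  qed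
  show thesis
  proof (rule that[of U A Y \<omega> \<delta>])
    show "periodic_profile \<rho> (c^2 * (1 - 2 * d^2) - \<rho>^2 / (2 * c^4)) U A Y \<omega> \<delta>"
      unfolding periodic_profile_def magnetic_profile_def K_def[symmetric]
      using \<omega> dU dA dY by (simp add: U_def A_def Y_def \<psi>per per Fper)
  qed (use closing start in auto)
qed

subsection \<open>The closing condition\<close>

text \<open>The parameter \<open>e\<close> cancels from \<open>K\<close>, so the whole family for
  given \<open>c\<close> and \<open>d\<close> obeys one scalar equation.\<close>

lemma associated_start:
  assumes c: "0 < c"
  shows "z0 \<rho> c d e + \<rho> = \<rho> / c^2 + 2 * c * d * e"
    and "y0 \<rho> c d e + 1 - (z0 \<rho> c d e + \<rho>)^2 / 2 = c^2 * (1 - 2 * d^2) - \<rho>^2 / (2 * c^4)"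
proof -
  show z: "z0 \<rho> c d e + \<rho> = \<rho> / c^2 + 2 * c * d * e"
    by (simp add: z0_def)
  show "y0 \<rho> c d e + 1 - (z0 \<rho> c d e + \<rho>)^2 / 2 = c^2 * (1 - 2 * d^2) - \<rho>^2 / (2 * c^4)"
    unfolding z y0_def using c by (simp add: field_simps power2_eq_square power4_eq_xxxx)
qed

text \<open>Without drift the curve built from the profile closes up. Conversely, a periodic
  trajectory with the same data keeps \<open>y\<close> bounded at nonnegative times, while
  \<open>n\<close> periods of the profile change \<open>y\<close> by
  \<open>n * \<delta>\<close>.\<close>

lemma ex_periodic_associated_iff:
  fixes \<rho> c d e :: real
  assumes c: "0 < c" and d: "0 < d" "d < 1" and e: "\<bar>e\<bar> \<le> 1"
  shows "(\<exists>\<gamma>. associated \<rho> c d e \<gamma> \<and> periodic \<gamma>) \<longleftrightarrow> closing \<rho> c d"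
proof -
  define K where "K = c^2 * (1 - 2 * d^2) - \<rho>^2 / (2 * c^4)"
  obtain U A Y \<omega> \<delta> where pp: "periodic_profile \<rho> K U A Y \<omega> \<delta>"
    and closing: "\<delta> = 0 \<longleftrightarrow> closing \<rho> c d"
    and start: "\<And>e. \<bar>e\<bar> \<le> 1 \<Longrightarrow> \<exists>t. U t = \<rho> / c^2 + 2 * c * d * e \<and> A t = x0 \<rho> c d e"
    by (rule periodic_profile_exists[OF c d, of \<rho>, folded K_def]) (rule that)
  have \<omega>: "\<omega> > 0" and prof: "magnetic_profile \<rho> K U A"
    and Y: "(Y has_field_derivative (U t)^2 / 2 + K - 1) (at t)"
    and per: "U (t + \<omega>) = U t" "A (t + \<omega>) = A t" "Y (t + \<omega>) = Y t + \<delta>" for t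
    using pp by (auto simp: periodic_profile_def)
  obtain s where s: "U s = \<rho> / c^2 + 2 * c * d * e" "A s = x0 \<rho> c d e"
    using start[OF e] by blast
  \<comment> \<open>Shifting time by \<open>s\<close> moves the common profile to the starting point
    belonging to \<open>e\<close>.\<close>
  define u a y where "u t = U (t + s)" and "a t = A (t + s)" and "y t = Y (t + s) - Y s" for t
  define \<gamma> where "\<gamma> = (\<lambda>t. vector [u t - u 0, y t, a 0 - a t - y t * (u t + u 0) / 2] :: real^3)"
  have ua: "magnetic_profile \<rho> K u a"
    using prof unfolding magnetic_profile_def u_def[abs_def] a_def[abs_def]
    by (blast intro: DERIV_shift[THEN iffD1])
  have y': "(y has_field_derivative (u t)^2 / 2 + K - 1) (at t)" for t
  proof -
    have "((\<lambda>t. Y (t + s)) has_field_derivative (u t)^2 / 2 + K - 1) (at t)"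
      using Y[of "t + s"] by (simp add: DERIV_shift u_def)
    from DERIV_diff[OF this DERIV_const] show ?thesis
      by (simp add: y_def[abs_def])
  qed
  have init: "u 0 = z0 \<rho> c d e + \<rho>" "a 0 = x0 \<rho> c d e" "y 0 = 0"
    by (simp_all add: u_def a_def y_def s associated_start(1)[OF c])
  have \<gamma>: "associated \<rho> c d e \<gamma>"
    unfolding \<gamma>_def using init
    by (intro associatedI[OF ua y']) (simp_all only: associated_start(2)[OF c] K_def)
  have shift: "t + \<omega> + s = t + s + \<omega>" for t
    by simp
  show ?thesis
  proof
    assume "closing \<rho> c d"
    then have "\<gamma> (t + \<omega>) = \<gamma> t" for t
      unfolding \<gamma>_def u_def a_def y_def shift per using closing by simp
    then have "periodic \<gamma>"
      using \<omega> by (auto simp: periodic_def)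
    then show "\<exists>\<gamma>. associated \<rho> c d e \<gamma> \<and> periodic \<gamma>"
      using \<gamma> by blast
  next
    assume "\<exists>\<gamma>. associated \<rho> c d e \<gamma> \<and> periodic \<gamma>"
    then obtain \<gamma>' p where \<gamma>': "associated \<rho> c d e \<gamma>'" and p: "p > 0" "\<And>t. \<gamma>' (t + p) = \<gamma>' t"
      by (auto simp: periodic_def)
    have eq: "y t = \<gamma>' t $ 2" if "t \<ge> 0" for t
      using associated_unique[OF \<gamma> \<gamma>' that] by (simp add: \<gamma>_def)
    have yp: "y (t + p) = y t" if "t \<ge> 0" for t
      using eq[of t] eq[of "t + p"] p that by simp
    have step: "y (t + real n * \<omega>) = y t + real n * \<delta>" for t n
    proof (induction n)
      case (Suc n)
      have "y (t + real (Suc n) * \<omega>) = y (t + real n * \<omega> + \<omega>)"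
        by (simp add: algebra_simps)
      also have "\<dots> = y (t + real n * \<omega>) + \<delta>"
        unfolding y_def shift per by simp
      finally show ?case
        using Suc by (simp add: algebra_simps)
    qed simp
    have conty: "continuous_on {0..p} y"
      using DERIV_isCont[OF y'] by (simp add: continuous_at_imp_continuous_on)
    then have "bounded (y ` {0..p})"
      by (intro compact_imp_bounded compact_continuous_image) auto
    then obtain B where B: "\<forall>t\<in>{0..p}. \<bar>y t\<bar> \<le> B"
      by (auto simp: bounded_iff)
    have shiftp: "y (t + real n * p) = y t" if "t \<ge> 0" for t n
    proof (induction n)
      case (Suc n)
      have "y (t + real (Suc n) * p) = y (t + real n * p + p)"
        by (simp add: algebra_simps)
      then show ?case
        using Suc yp[of "t + real n * p"] that p(1) by simp
    qed simp
    have bound: "\<bar>y t\<bar> \<le> B" if t: "t \<ge> 0" for t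
    proof -
      define n where "n = nat \<lfloor>t / p\<rfloor>"
      have "real n \<le> t / p" "t / p < real n + 1"
        using t p(1) by (simp_all add: n_def)
      then have "0 \<le> t - real n * p" "t - real n * p \<le> p"
        using p(1) by (simp_all add: field_simps)
      then show ?thesis
        using bspec[OF B, of "t - real n * p"] shiftp[of "t - real n * p" n] by simp
    qed
    have "real n * \<bar>\<delta>\<bar> \<le> B" for n
      using step[of 0 n] bound[of "real n * \<omega>"] \<omega> init(3) by (simp add: abs_mult)
    then have "\<delta> = 0"
      using reals_Archimedean3[of "\<bar>\<delta>\<bar>"] by (metis abs_eq_0 abs_ge_zero less_le not_le)
    then show "closing \<rho> c d"
      using closing by simp
  qed
qed

section \<open>The closing condition parametrised by \<open>nu\<close> and
  \<open>gap\<close>\<close>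

definition nu :: "real \<Rightarrow> real" where "nu m = 1 / ell_ratio m"
definition gap :: "real \<Rightarrow> real" where "gap m = (nu m)^2 - 2 * nu m * (1 - 2 * m) + 1"
text \<open>The closing condition \<open>S g(m) = r\<^sup>2 + 1 / c\<^sup>2\<close> forces \<open>g(m) > 0\<close>.\<close>

definition admissible :: "real set" where "admissible = {m. 0 < m \<and> m < 1 \<and> 0 < ell_ratio m}"

text \<open>In this form positivity and growth with \<open>m\<close> can be seen directly from those
  of \<open>nu\<close>.\<close>

lemma gap_alt: "gap m = (nu m - 1)^2 + 4 * m * nu m"
  unfolding gap_def by algebra

lemma admissibleD:
  assumes "m \<in> admissible"
  shows "0 < m" "m < 1" "0 < ell_ratio m" "1 < nu m" "0 < gap m"
proof -
  show m: "0 < m" "m < 1" "0 < ell_ratio m"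
    using assms by (auto simp: admissible_def)
  then show "1 < nu m"
    using ell_ratio_less_1[of m] by (simp add: nu_def)
  then show "0 < gap m"
    unfolding gap_alt using m by (intro add_nonneg_pos) auto
qed

text \<open>As \<open>ell_ratio\<close> decreases, positivity is inherited by smaller
  parameters.\<close>

lemma admissible_down:
  assumes "m' \<in> admissible" "0 < m" "m \<le> m'"
  shows "m \<in> admissible"
proof (cases "m = m'")
  case False
  then have "ell_ratio m' < ell_ratio m"
    using assms by (intro ell_ratio_strict_antimono) (auto simp: admissible_def)
  then show ?thesis
    using assms by (auto simp: admissible_def)
qed (use assms in simp)

lemma nu_gap_strict_mono:
  assumes "m \<in> admissible" "m' \<in> admissible" "m < m'"
  shows "nu m < nu m'" "gap m < gap m'"
proof -
  note D = admissibleD[OF assms(1)] and D' = admissibleD[OF assms(2)]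
  have "ell_ratio m' < ell_ratio m"
    using ell_ratio_strict_antimono[of m m'] D D' assms(3) by simp
  then show nu: "nu m < nu m'"
    using D(3) D'(3) by (simp add: nu_def frac_less2)
  have "(nu m - 1)^2 < (nu m' - 1)^2"
    using nu D(4) by (intro power_strict_mono) auto
  moreover have "m * nu m < m' * nu m'"
    using nu assms(3) D D' by (intro mult_strict_mono) auto
  ultimately show "gap m < gap m'"
    by (simp add: gap_alt)
qed

lemma admissible_segment:
  assumes "m \<in> admissible" "0 \<le> x" "x \<le> m"
  shows "0 \<le> x" "x < 1" "0 < ell_ratio x"
proof -
  show "0 \<le> x" "x < 1"
    using assms admissibleD(2)[OF assms(1)] by auto
  show "0 < ell_ratio x"
    using admissible_down[OF assms(1)] assms by (cases "x = 0") (auto simp: ell_ratio_0 admissible_def)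
qed

lemma continuous_on_nu_gap:
  assumes "m \<in> admissible"
  shows "continuous_on {0..m} nu" "continuous_on {0..m} gap"
proof -
  have "continuous_on {0..m} ell_ratio"
    using admissibleD(2)[OF assms] by (auto intro: continuous_on_subset[OF continuous_on_ell_ratio])
  moreover have "ell_ratio x \<noteq> 0" if "x \<in> {0..m}" for x
    using admissible_segment(3)[OF assms, of x] that by simp
  ultimately show nu: "continuous_on {0..m} nu"
    unfolding nu_def[abs_def] by (intro continuous_intros) auto
  then show "continuous_on {0..m} gap"
    unfolding gap_def[abs_def] by (intro continuous_intros)
qed

lemma nu_surj:
  assumes "1 < y"
  obtains m where "m \<in> admissible" "nu m = y"
proof -
  obtain m where "0 < m" "m < 1" "ell_ratio m = 1 / y"
    using ell_ratio_surj[of "1 / y"] assms by auto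
  then show thesis
    using that[of m] assms by (simp add: admissible_def nu_def)
qed

text \<open>0 is not admissible, but the values there are the lower ends for the intermediate value
  theorem.\<close>

lemma nu_gap_0: "nu 0 = 1" "gap 0 = 0"
  by (simp_all add: gap_def nu_def ell_ratio_0)

lemma nu_gap_combination_surj:
  assumes \<tau>: "0 \<le> \<tau>" and y: "1 < y"
  obtains m where "m \<in> admissible" "(nu m)^2 + \<tau> * gap m = y"
proof -
  \<comment> \<open>With this \<open>M\<close> the first summand alone already reaches
    \<open>y\<close>.\<close>
  obtain M where M: "M \<in> admissible" "nu M = sqrt y"
    using nu_surj[of "sqrt y"] y by auto
  have "\<exists>x\<ge>0. x \<le> M \<and> (nu x)^2 + \<tau> * gap x = y"
    using y \<tau> admissibleD[OF M(1)] continuous_on_nu_gap[OF M(1)]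
    by (intro IVT') (auto simp: nu_gap_0 M(2) intro!: continuous_intros)
  then obtain x where x: "0 \<le> x" "x \<le> M" "(nu x)^2 + \<tau> * gap x = y" by blast
  then have "x \<noteq> 0"
    using y by (auto simp: nu_gap_0)
  then show thesis
    using that[of x] x admissible_down[OF M(1)] by simp
qed

lemma gap_surj:
  assumes "0 < y"
  obtains m where "m \<in> admissible" "gap m = y"
proof -
  \<comment> \<open>This choice makes the square in \<open>gap_alt\<close> equal to
    \<open>y\<close>.\<close>
  obtain M where M: "M \<in> admissible" "nu M = 1 + sqrt y"
    using nu_surj[of "1 + sqrt y"] assms by auto
  have "y \<le> gap M"
    using admissibleD[OF M(1)] assms by (simp add: gap_alt M(2))
  then have "\<exists>x\<ge>0. x \<le> M \<and> gap x = y"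
    using assms admissibleD[OF M(1)] continuous_on_nu_gap[OF M(1)]
    by (intro IVT') (auto simp: nu_gap_0)
  then obtain x where x: "0 \<le> x" "x \<le> M" "gap x = y" by blast
  then have "x \<noteq> 0"
    using assms by (auto simp: nu_gap_0)
  then show thesis
    using that[of x] x admissible_down[OF M(1)] by simp
qed

text \<open>Closing says \<open>c^2 * S = nu m * (1 + \<tau>)\<close>. Inserting this into the
  equation defining \<open>m\<close> gives \<open>d^2\<close>, and then the formula for
  \<open>S^2\<close> gives \<open>c^4\<close>.\<close>

lemma closing_imp_parameter:
  fixes \<rho> c d :: real
  assumes c: "0 < c" and d: "0 < d" "d < 1" and closing: "closing \<rho> c d"
  defines "\<tau> \<equiv> \<rho>^2 / c^4"
  obtains m where "m \<in> admissible" "c^4 = (1 + \<tau>) * ((nu m)^2 + \<tau> * gap m) - \<tau>"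
    "2 * d^2 * c^2 = c^2 + \<tau> - (1 - 2 * m) * nu m * (1 + \<tau>)"
proof -
  define r where "r = \<rho> / c^3"
  define m where "m = modulus r d"
  define S where "S = quartic_scale r d"
  have S: "S > 0" "S^2 = (1 + r^2)^2 - 4 * r^2 * d^2" "2 * S * m = S - (1 + r^2 - 2 * d^2)"
    using quartic_scale_pos[OF d] quartic_scale_sq[OF d] modulus_eq[OF d]
    by (simp_all add: S_def m_def)
  have m: "0 < m" "m < 1"
    using modulus_bounds[OF d] by (simp_all add: m_def)
  have r: "\<tau> = c^2 * r^2"
    using c by (simp add: \<tau>_def r_def power_divide power2_eq_square power3_eq_cube power4_eq_xxxx)
  have \<tau>: "0 \<le> \<tau>"
    by (simp add: \<tau>_def)
  have "S * ell_ratio m = r^2 + 1 / c^2"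
    using closing by (simp add: closing_def S_def m_def r_def)
  then have Sg: "c^2 * S * ell_ratio m = 1 + \<tau>"
    using c by (simp add: r field_simps)
  then have "0 < c^2 * S * ell_ratio m"
    using \<tau> by simp
  then have g: "0 < ell_ratio m"
    by (rule zero_less_mult_pos) (use c S(1) in simp)
  then have adm: "m \<in> admissible"
    using m by (simp add: admissible_def)
  have Sv: "c^2 * S = nu m * (1 + \<tau>)"
    using Sg g by (simp add: nu_def field_simps)
  have d2: "2 * d^2 * c^2 = c^2 + \<tau> - (1 - 2 * m) * nu m * (1 + \<tau>)"
    using S(3) Sv r by algebra
  have "c^4 = (1 + \<tau>) * ((nu m)^2 + \<tau> * gap m) - \<tau>"
    using S(2) Sv r d2 gap_def[of m] by algebra
  with adm d2 show thesis
    by (intro that)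
qed

text \<open>\<open>S\<close> is read off from the closing condition and \<open>D2\<close>, the
  future \<open>d^2\<close>, from the equation for \<open>m\<close>. Then
  \<open>D2 * (1 - D2) = S^2 * m * (1 - m)\<close> is positive, which puts \<open>D2\<close> between
  0 and 1.\<close>

lemma parameter_imp_closing:
  fixes \<rho> c m :: real
  defines "\<tau> \<equiv> \<rho>^2 / c^4"
  assumes c: "0 < c" and m: "m \<in> admissible" and eq: "c^4 = (1 + \<tau>) * ((nu m)^2 + \<tau> * gap m) - \<tau>"
  obtains d where "0 < d" "d < 1" "closing \<rho> c d"
    "2 * d^2 * c^2 = c^2 + \<tau> - (1 - 2 * m) * nu m * (1 + \<tau>)"
proof -
  define r where "r = \<rho> / c^3"
  have r: "\<tau> = c^2 * r^2"
    using c by (simp add: \<tau>_def r_def power_divide power2_eq_square power3_eq_cube power4_eq_xxxx)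
  have \<tau>: "0 \<le> \<tau>"
    by (simp add: \<tau>_def)
  note D = admissibleD[OF m]
  define S where "S = nu m * (1 + \<tau>) / c^2"
  have S: "S > 0" and Sv: "c^2 * S = nu m * (1 + \<tau>)"
    using D(4) \<tau> c by (simp_all add: S_def)
  define D2 where "D2 = (1 + r^2 - (1 - 2 * m) * S) / 2"
  have X: "1 + r^2 - 2 * D2 = (1 - 2 * m) * S"
    by (simp add: D2_def field_simps)
  have "c^4 * S^2 = c^4 * ((1 + r^2)^2 - 4 * r^2 * D2)"
    using Sv r X gap_def[of m] eq by algebra
  then have S2: "S^2 = (1 + r^2)^2 - 4 * r^2 * D2"
    using c by simp
  have "4 * (D2 * (1 - D2)) = S^2 * (4 * (m * (1 - m)))"
    using S2 X by algebra
  also have "\<dots> > 0"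
    using S D by simp
  finally have D2: "0 < D2" "D2 < 1"
    by (auto simp: zero_less_mult_iff)
  define d where "d = sqrt D2"
  have d: "0 < d" "d < 1" "d^2 = D2"
    using D2 by (simp_all add: d_def)
  have "quartic_scale r d = S"
    using S S2 by (simp add: quartic_scale_def d(3) flip: S2)
  moreover have "modulus r d = m"
    using S X by (simp add: modulus_def calculation d(3))
  moreover have "S * ell_ratio m = r^2 + 1 / c^2"
    using D(3) c by (simp add: S_def nu_def r field_simps)
  ultimately have "closing \<rho> c d"
    by (simp add: closing_def r_def)
  moreover have "2 * d^2 * c^2 = c^2 + \<tau> - (1 - 2 * m) * nu m * (1 + \<tau>)"
    using X Sv r d(3) by algebra
  ultimately show thesis
    using d(1,2) by (intro that)
qed

text \<open>For fixed \<open>c\<close>, and so fixed \<open>\<tau>\<close>, the right side of the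
  equation for \<open>c^4\<close> strictly increases with \<open>m\<close>, and \<open>m\<close>
  determines \<open>d\<close>.\<close>

lemma closing_unique:
  assumes c: "0 < c" and d: "0 < d" "d < 1" "closing \<rho> c d" and d': "0 < d'" "d' < 1" "closing \<rho> c d'"
  shows "d = d'"
proof -
  define \<tau> where "\<tau> = \<rho>^2 / c^4"
  have \<tau>: "0 \<le> \<tau>"
    by (simp add: \<tau>_def)
  obtain m where m: "m \<in> admissible" "c^4 = (1 + \<tau>) * ((nu m)^2 + \<tau> * gap m) - \<tau>"
    "2 * d^2 * c^2 = c^2 + \<tau> - (1 - 2 * m) * nu m * (1 + \<tau>)"
    using closing_imp_parameter[OF c d] unfolding \<tau>_def by blast
  obtain m' where m': "m' \<in> admissible" "c^4 = (1 + \<tau>) * ((nu m')^2 + \<tau> * gap m') - \<tau>"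
    "2 * d'^2 * c^2 = c^2 + \<tau> - (1 - 2 * m') * nu m' * (1 + \<tau>)"
    using closing_imp_parameter[OF c d'] unfolding \<tau>_def by blast
  have less: "(nu x)^2 + \<tau> * gap x < (nu y)^2 + \<tau> * gap y" if "x \<in> admissible" "y \<in> admissible" "x < y" for x y
  proof -
    have "(nu x)^2 < (nu y)^2"
      using nu_gap_strict_mono(1)[OF that] admissibleD(4)[OF that(1)] by (intro power_strict_mono) auto
    moreover have "\<tau> * gap x \<le> \<tau> * gap y"
      using nu_gap_strict_mono(2)[OF that] \<tau> by (intro mult_left_mono) auto
    ultimately show ?thesis by linarith
  qed
  have "(nu m)^2 + \<tau> * gap m = (nu m')^2 + \<tau> * gap m'"
    using m(2) m'(2) \<tau> by simp
  then have "m = m'"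
    using less[OF m(1) m'(1)] less[OF m'(1) m(1)] by (cases m m' rule: linorder_cases) auto
  then have "2 * d^2 * c^2 = 2 * d'^2 * c^2"
    using m(3) m'(3) by simp
  then have "d^2 = d'^2"
    using c by simp
  then show ?thesis
    using d(1) d'(1) by (simp add: power2_eq_iff_nonneg)
qed

lemma closing_exists:
  assumes c: "1 < c"
  obtains d where "0 < d" "d < 1" "closing \<rho> c d"
proof -
  define \<tau> where "\<tau> = \<rho>^2 / c^4"
  have \<tau>: "0 \<le> \<tau>"
    by (simp add: \<tau>_def)
  have "1 < c^4"
    using c by (simp add: one_less_power)
  \<comment> \<open>Here \<open>c > 1\<close> enters: 1 is the value of the combination at
    \<open>m = 0\<close>.\<close>
  then have "1 < (c^4 + \<tau>) / (1 + \<tau>)"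
    using \<tau> by simp
  from nu_gap_combination_surj[OF \<tau> this]
  obtain m where m: "m \<in> admissible" "(nu m)^2 + \<tau> * gap m = (c^4 + \<tau>) / (1 + \<tau>)" .
  have "c^4 = (1 + \<tau>) * ((nu m)^2 + \<tau> * gap m) - \<tau>"
    using \<tau> unfolding m(2) by simp
  then show thesis
    using parameter_imp_closing[of c m \<rho>] c m(1) that unfolding \<tau>_def by auto
qed

text \<open>The sum of squares simplifies to
  \<open>(1 + \<tau>) * ((c^2 - 1)^2 + 4 * c^2 * d^2)\<close>, free of \<open>e\<close>; the two
  parameter equations turn the second factor into \<open>(1 + \<tau>)^2 * gap m\<close>.\<close>

lemma energy_closing:
  assumes c: "0 < c" and d: "0 < d" "d < 1" and e: "\<bar>e\<bar> \<le> 1"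
    and m: "2 * d^2 * c^2 = c^2 + \<tau> - (1 - 2 * m) * nu m * (1 + \<tau>)"
      "c^4 = (1 + \<tau>) * ((nu m)^2 + \<tau> * gap m) - \<tau>" and \<tau>: "\<tau> = \<rho>^2 / c^4"
  shows "(x0 \<rho> c d e)^2 + (y0 \<rho> c d e)^2 + (z0 \<rho> c d e)^2 = (1 + \<tau>)^3 * gap m"
proof -
  define r where "r = \<rho> / c^3"
  have \<rho>: "\<rho> = c^3 * r"
    using c by (simp add: r_def)
  have r: "\<tau> = c^2 * r^2"
    using c by (simp add: \<tau> r_def power_divide power2_eq_square power3_eq_cube power4_eq_xxxx)
  have "d^2 \<le> 1" "e^2 \<le> 1"
    using d e by (simp_all add: abs_square_le_1)
  then have "(x0 \<rho> c d e)^2 = (2 * d / c)^2 * (1 - e^2) * ((c^3 * d * e + \<rho>)^2 + (1 - d^2) * c^6)"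
    unfolding x0_def power_mult_distrib using c by simp
  also have "(c^3 * d * e + \<rho>)^2 + (1 - d^2) * c^6 = (c * c^2)^2 * ((d * e + r)^2 + (1 - d^2))"
    unfolding \<rho> by algebra
  finally have x: "(x0 \<rho> c d e)^2 = 4 * d^2 * c^4 * (1 - e^2) * ((d * e + r)^2 + (1 - d^2))"
    using c by (simp add: power_mult_distrib power_divide power2_eq_square power4_eq_xxxx)
  have y: "y0 \<rho> c d e = c^2 * (2 * d^2 * e^2 - 2 * d^2 + 1 + 2 * d * e * r) - 1"
    using c by (simp add: y0_def \<rho> power2_eq_square power3_eq_cube algebra_simps)
  have z: "z0 \<rho> c d e = c * r + 2 * c * d * e - c^3 * r"
    using c by (simp add: z0_def \<rho> power2_eq_square power3_eq_cube)
  have "(x0 \<rho> c d e)^2 + (y0 \<rho> c d e)^2 + (z0 \<rho> c d e)^2 = (1 + \<tau>) * ((c^2 - 1)^2 + 4 * c^2 * d^2)"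
    unfolding x y z r by algebra
  also have "(c^2 - 1)^2 + 4 * c^2 * d^2 = (1 + \<tau>)^2 * gap m"
    using m gap_def[of m] by algebra
  finally show ?thesis
    by (simp add: power2_eq_square power3_eq_cube)
qed

subsection \<open>One period family for each energy\<close>

text \<open>By the Riccati equation, \<open>v'\<close> is the derivative of \<open>v = 1 / g\<close> with respect to \<open>m\<close>, where \<open>q = 1 - 2 m\<close>.\<close>

lemma nu_growth:
  fixes g q :: real
  assumes g: "0 < g" "g \<le> 1" and q: "\<bar>q\<bar> < 1"
  defines "v \<equiv> 1 / g" and "v' \<equiv> (1 + (g - q)^2 / (1 - q^2)) / g^2"
  shows "v' * (3 * (1 - q^2) - (v - q)^2) \<le> 8 * v * (v - q)"
proof -
  have q2: "0 < 1 - q^2"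
    using q by (simp add: abs_square_less_1)
  have v: "1 \<le> v" "v * g = 1"
    using g by (simp_all add: v_def)
  have v'0: "0 \<le> v'"
    using q2 by (simp add: v'_def)
  have "v' * (3 * (1 - q^2)) = 3 * v^2 * ((1 - q^2) + (g - q)^2)"
  proof -
    have "(1 + X / w) / g^2 * (3 * w) = 3 * (1 / g)^2 * (w + X)" if "0 < w" for X w
      using that g by (simp add: field_simps)
    from this[OF q2] show ?thesis
      unfolding v'_def v_def .
  qed
  also have "\<dots> = 3 * v^2 - 6 * v * q + 3"
    using v(2) by algebra
  \<comment> \<open>The difference of the sides is \<open>5 * v^2 - 2 * v * q - 3\<close>, which by
    \<open>q \<le> 1\<close> is at least \<open>(v - 1) * (5 * v + 3)\<close>.\<close>
  also have "\<dots> \<le> 8 * v * (v - q)"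
  proof -
    have "v * q \<le> v * 1"
      using q v by (intro mult_left_mono) auto
    moreover have "0 \<le> (v - 1) * (5 * v + 3)"
      using v by (intro mult_nonneg_nonneg) auto
    ultimately show ?thesis
      by (simp add: power2_eq_square algebra_simps)
  qed
  finally show ?thesis
    using mult_nonneg_nonneg[OF v'0 zero_le_power2[of "v - q"]]
    by (simp only: right_diff_distrib[of v'])
qed

text \<open>The final inequality is \<open>nu_growth\<close> rewritten with
  \<open>gap m = (nu m - q)^2 + (1 - q^2)\<close>; it controls the sign of the derivative of
  \<open>charge\<close>.\<close>

lemma DERIV_nu_gap:
  assumes m: "m \<in> admissible"
  obtains v' where "0 < v'" "(nu has_field_derivative v') (at m)"
    "(gap has_field_derivative 2 * v' * (nu m - (1 - 2 * m)) + 4 * nu m) (at m)"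
    "3 * gap m * v' \<le> 4 * (nu m - (1 - 2 * m)) * (v' * (nu m - (1 - 2 * m)) + 2 * nu m)"
proof -
  note D = admissibleD[OF m]
  define q where "q = 1 - 2 * m"
  define v' where "v' = (1 + (ell_ratio m - q)^2 / (1 - q^2)) / (ell_ratio m)^2"
  have q: "\<bar>q\<bar> < 1"
    using D by (simp add: q_def abs_if)
  have der: "(nu has_field_derivative v') (at m)"
  proof -
    have "(nu has_field_derivative (0 * ell_ratio m - 1 * - (1 + (ell_ratio m - q)^2 / (1 - q^2))) / (ell_ratio m * ell_ratio m)) (at m)"
      unfolding nu_def[abs_def] q_def
      by (rule DERIV_divide[OF DERIV_const DERIV_ell_ratio[OF D(1,2)]]) (use D(3) in simp)
    then show ?thesis
      by (rule DERIV_cong) (simp only: v'_def power2_eq_square mult_zero_left mult_1_left diff_0 minus_minus)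
  qed
  have "0 < 1 - q^2"
    using q by (simp add: abs_square_less_1)
  then have pos: "0 < v'"
    unfolding v'_def using D(3) by (intro divide_pos_pos add_pos_nonneg) auto
  have "(gap has_field_derivative 2 * v' * (nu m - (1 - 2 * m)) + 4 * nu m) (at m)"
    unfolding gap_def[abs_def]
    by (rule derivative_eq_intros der refl | simp add: algebra_simps)+
  moreover have "3 * gap m * v' \<le> 4 * (nu m - q) * (v' * (nu m - q) + 2 * nu m)"
  proof -
    have "v' * (3 * (1 - q^2) - (nu m - q)^2) \<le> 8 * nu m * (nu m - q)"
      using nu_growth[OF D(3) _ q] ell_ratio_less_1[OF D(1,2)] by (simp add: v'_def nu_def)
    moreover have "gap m = (nu m - q)^2 + (1 - q^2)"
      by (simp add: gap_def q_def power2_eq_square algebra_simps)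
    then have "4 * (nu m - q) * (v' * (nu m - q) + 2 * nu m) - 3 * gap m * v'
        = 8 * nu m * (nu m - q) - v' * (3 * (1 - q^2) - (nu m - q)^2)"
      by algebra
    ultimately show ?thesis
      by linarith
  qed
  ultimately show thesis
    using pos der by (intro that[of v']) (simp_all add: q_def)
qed

text \<open>For \<open>P = 2 \<E>\<close>, these are \<open>1 / (1 + \<tau>)\<close> and \<open>\<rho>\<^sup>2\<close> as functions of \<open>m\<close> at fixed energy.\<close>

definition shrink :: "real \<Rightarrow> real \<Rightarrow> real" where "shrink P m = root 3 (gap m / P)"

definition charge :: "real \<Rightarrow> real \<Rightarrow> real" where
  "charge P m = (1 - shrink P m) * (1 / shrink P m + ((nu m)^2 - 1) / (shrink P m)^2 + P * (1 - shrink P m))"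

lemma shrink_cube:
  assumes "0 < P" "m \<in> admissible"
  shows "0 < shrink P m" "P * (shrink P m)^3 = gap m"
  using assms admissibleD(5)[OF assms(2)] by (simp_all add: shrink_def)

text \<open>Justifies the formula for \<open>charge\<close>: with h = 1 / (1 + \<tau>) it becomes
  \<tau> times the expression that the closing condition equates with c^4.\<close>

lemma charge_eq:
  assumes P: "0 < P" and m: "m \<in> admissible" and P\<tau>: "P = (1 + \<tau>)^3 * gap m" and \<tau>: "0 \<le> \<tau>"
  shows "shrink P m = 1 / (1 + \<tau>)" "charge P m = \<tau> * ((1 + \<tau>) * ((nu m)^2 + \<tau> * gap m) - \<tau>)"
proof -
  have "gap m / P = (1 / (1 + \<tau>))^3"
    using \<tau> admissibleD(5)[OF m] unfolding P\<tau> by (simp add: power_divide)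
  then show h: "shrink P m = 1 / (1 + \<tau>)"
    using \<tau> by (simp add: shrink_def real_root_power_cancel)
  define h where "h = 1 / (1 + \<tau>)"
  have h1: "h * (1 + \<tau>) = 1" "h \<noteq> 0"
    using \<tau> by (simp_all add: h_def)
  have inv: "1 / h = 1 + \<tau>" "z / h^2 = z * (1 + \<tau>)^2" for z
    by (simp_all add: h_def power_divide)
  have "charge P m = (1 - h) * ((1 + \<tau>) + ((nu m)^2 - 1) * (1 + \<tau>)^2 + P * (1 - h))"
    unfolding charge_def h h_def[symmetric] inv ..
  also have "\<dots> = \<tau> * ((1 + \<tau>) * ((nu m)^2 + \<tau> * gap m) - \<tau>)"
    using h1(1) P\<tau> by algebra
  finally show "charge P m = \<tau> * ((1 + \<tau>) * ((nu m)^2 + \<tau> * gap m) - \<tau>)" .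
qed

text \<open>The derivative is a negative multiple of \<open>h'\<close> plus
  \<open>(1 - h) * Z\<close>. Up to a positive factor, \<open>Z \<le> 0\<close> is the inequality of
  \<open>DERIV_nu_gap\<close>, and \<open>gap m < P\<close> gives \<open>h < 1\<close>.\<close>

lemma charge_derivative_neg:
  assumes P: "0 < P" and m: "m \<in> admissible" and le: "gap m < P"
  obtains D where "(charge P has_field_derivative D) (at m)" "D < 0"
proof -
  obtain v' where v': "0 < v'" and nu': "(nu has_field_derivative v') (at m)"
    and gap': "(gap has_field_derivative 2 * v' * (nu m - (1 - 2 * m)) + 4 * nu m) (at m)"
    and ineq: "3 * gap m * v' \<le> 4 * (nu m - (1 - 2 * m)) * (v' * (nu m - (1 - 2 * m)) + 2 * nu m)"
    using DERIV_nu_gap[OF m] by blast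
  note A = admissibleD[OF m]
  define q v h G' where "q = 1 - 2 * m" and "v = nu m" and "h = shrink P m"
    and "G' = 2 * v' * (nu m - (1 - 2 * m)) + 4 * nu m"
  have h: "0 < h" "P * h^3 = gap m"
    using shrink_cube[OF P m] by (simp_all add: h_def)
  have "h < 1"
  proof -
    have "h^3 < 1^3"
      using h(2) le P by (metis mult.right_neutral mult_less_cancel_left_pos power_one)
    then show ?thesis
      by (rule power_less_imp_less_base) simp
  qed
  have vq: "0 < v - q"
    using A by (simp add: v_def q_def)
  have G': "0 < G'"
    unfolding G'_def using v' vq A(4) by (intro add_pos_pos) (auto simp: v_def q_def)
  define h' where "h' = G' / (3 * P * h^2)"
  have h': "0 < h'"
    using G' P h(1) by (simp add: h'_def)
  have dh: "(shrink P has_field_derivative h') (at m)"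
  proof -
    have "((\<lambda>m. gap m / P) has_field_derivative G' / P) (at m)"
      unfolding G'_def by (rule DERIV_cdivide[OF gap'])
    from DERIV_chain2[OF DERIV_real_root[of 3] this] A(5) P
    have "(shrink P has_field_derivative inverse (real 3 * root 3 (gap m / P) ^ (3 - Suc 0)) * (G' / P)) (at m)"
      unfolding shrink_def[abs_def] by simp
    then show ?thesis
      by (simp add: h'_def h_def shrink_def field_simps)
  qed
  define Z where "Z = 2 * v * v' / h^2 - 2 * h' * ((v^2 - 1) / h^3 + P)"
  have "(charge P has_field_derivative
      - h' * (1 / h + (v^2 - 1) / h^2 + P * (1 - h))
      + (1 - h) * (- h' / h^2 + (2 * v * v' * h^2 - (v^2 - 1) * (2 * h * h')) / (h^2 * h^2) - P * h')) (at m)"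
    unfolding charge_def[abs_def] v_def h_def
    by (rule derivative_eq_intros dh nu' refl | use h(1) in \<open>simp add: h_def power2_eq_square\<close>)+
  also have "- h' * (1 / h + (v^2 - 1) / h^2 + P * (1 - h))
      + (1 - h) * (- h' / h^2 + (2 * v * v' * h^2 - (v^2 - 1) * (2 * h * h')) / (h^2 * h^2) - P * h')
      = - h' * (1 / h + (v^2 - 1) / h^2 + (1 - h) / h^2) + (1 - h) * Z"
    unfolding Z_def using h(1) by (simp add: divide_simps) algebra
  finally have der: "(charge P has_field_derivative
      - h' * (1 / h + (v^2 - 1) / h^2 + (1 - h) / h^2) + (1 - h) * Z) (at m)" .
  have "Z \<le> 0"
  proof -
    have "3 * gap m * h^2 * Z = 2 * (3 * gap m * v * v' - G' * (v^2 - 1 + gap m))"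
    proof -
      have eqG: "h' * (3 * P * h^2) = G'"
        using P h(1) by (simp add: h'_def)
      have eqZ: "h^3 * Z = 2 * v * v' * h - 2 * h' * ((v^2 - 1) + P * h^3)"
        unfolding Z_def using h(1) by (simp add: field_simps power2_eq_square power3_eq_cube)
      have "3 * gap m * h * (h^3 * Z) = h^2 * (2 * (3 * gap m * v * v' - G' * (v^2 - 1 + gap m)))"
        unfolding h(2)[symmetric] eqZ eqG[symmetric] by algebra
      then have "h^2 * (3 * gap m * h^2 * Z) = h^2 * (2 * (3 * gap m * v * v' - G' * (v^2 - 1 + gap m)))"
        by (simp only: power2_eq_square power3_eq_cube mult_ac)
      then show ?thesis
        using h(1) by simp
    qed
    also have "\<dots> \<le> 0"
    proof -
      \<comment> \<open>This identity makes \<open>v\<close> a common factor and leaves exactly the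
        difference of the two sides of \<open>ineq\<close>.\<close>
      have "v^2 - 1 + gap m = 2 * v * (v - q)"
        by (simp add: gap_def v_def q_def power2_eq_square algebra_simps)
      then have "G' * (v^2 - 1 + gap m) - 3 * gap m * v * v'
        = v * (4 * (v - q) * (v' * (v - q) + 2 * v) - 3 * gap m * v')"
        unfolding G'_def v_def q_def by algebra
      also have "\<dots> \<ge> 0"
        using ineq A(4) by (intro mult_nonneg_nonneg) (simp_all add: v_def q_def)
      finally have "0 \<le> G' * (v^2 - 1 + gap m) - 3 * gap m * v * v'" .
      moreover have "2 * (a - b) \<le> 0" if "0 \<le> b - a" for a b :: real
        using that by simp
      ultimately show ?thesis by blast
    qed
    finally show ?thesis
      using A(5) h(1) by (simp add: mult_le_0_iff)
  qed
  moreover have "0 < 1 / h + (v^2 - 1) / h^2 + (1 - h) / h^2"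
    using h(1) \<open>h < 1\<close> A(4) by (intro add_pos_nonneg) (auto simp: v_def)
  ultimately have "- h' * (1 / h + (v^2 - 1) / h^2 + (1 - h) / h^2) + (1 - h) * Z < 0"
    using h' \<open>h < 1\<close> by (intro add_neg_nonpos) (auto intro: mult_neg_pos mult_nonneg_nonpos)
  with der show thesis
    by (rule that)
qed

lemma continuous_on_charge:
  assumes P: "0 < P" and a: "0 < a" and b: "b \<in> admissible"
  shows "continuous_on {a..b} (charge P)"
proof -
  have cont: "continuous_on {a..b} nu" "continuous_on {a..b} gap"
    using continuous_on_nu_gap[OF b] a by (auto intro: continuous_on_subset)
  moreover have "shrink P x \<noteq> 0" if "x \<in> {a..b}" for x
    using shrink_cube(1)[OF P admissible_down[OF b]] a that by (metis atLeastAtMost_iff less_irrefl order_less_le_trans)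
  ultimately show ?thesis
    unfolding charge_def[abs_def] using P
    by (intro continuous_intros) (auto simp: shrink_def[abs_def] intro!: continuous_intros)
qed

text \<open>The derivative is used only strictly inside the interval, where \<open>gap < P\<close>;
  so \<open>gap m' = P\<close>, the case of charge 0, may occur at the right end.\<close>

lemma charge_strict_antimono:
  assumes P: "0 < P" and m: "m \<in> admissible" "m' \<in> admissible" and less: "m < m'" and le: "gap m' \<le> P"
  shows "charge P m' < charge P m"
proof (rule DERIV_neg_imp_decreasing_open[OF less])
  fix x assume x: "m < x" "x < m'"
  then have adm: "x \<in> admissible"
    using admissible_down[OF m(2)] admissibleD(1)[OF m(1)] by simp
  then have "gap x < P"
    using nu_gap_strict_mono(2)[OF adm m(2) x(2)] le by simp
  then show "\<exists>y. DERIV (charge P) x :> y \<and> y < 0"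
    using charge_derivative_neg[OF P adm] by blast
qed (use continuous_on_charge[OF P admissibleD(1)[OF m(1)] m(2)] in simp)

lemma charge_surj:
  assumes P: "0 < P" and y: "0 \<le> y"
  obtains m where "m \<in> admissible" "gap m \<le> P" "charge P m = y"
proof -
  obtain b where b: "b \<in> admissible" "gap b = P"
    using gap_surj[OF P] .
  \<comment> \<open>This \<open>a\<close> corresponds to \<tau> = y. There the charge is
    \<open>y\<close> times a factor at least 1, while it is 0 at \<open>b\<close>.\<close>
  obtain a where a: "a \<in> admissible" "gap a = P / (1 + y)^3"
    using gap_surj[of "P / (1 + y)^3"] P y by auto
  have "gap a \<le> gap b"
    using P y by (simp add: a b divide_le_eq)
  then have ab: "a \<le> b"
    using nu_gap_strict_mono(2)[OF b(1) a(1)] by (meson linorder_not_le)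
  have "charge P b = 0"
    using P by (simp add: charge_def shrink_def b)
  moreover have "y \<le> charge P a"
  proof -
    have "P = (1 + y)^3 * gap a"
      using y by (simp add: a)
    then have "charge P a = y * ((1 + y) * ((nu a)^2 + y * gap a) - y)"
      by (rule charge_eq(2)[OF P a(1) _ y])
    moreover have "y * 1 \<le> y * ((1 + y) * ((nu a)^2 + y * gap a) - y)"
    proof -
      have "1 \<le> (nu a)^2" "0 \<le> y * gap a"
        using y admissibleD(4,5)[OF a(1)] by (simp_all add: one_le_power)
      then have "(1 + y) * 1 \<le> (1 + y) * ((nu a)^2 + y * gap a)"
        using y by (intro mult_left_mono) linarith+
      then have "1 \<le> (1 + y) * ((nu a)^2 + y * gap a) - y"
        by (simp only: le_diff_eq mult_1_right)
      then show ?thesis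
        using y by (rule mult_left_mono)
    qed
    ultimately show ?thesis by simp
  qed
  ultimately have "\<exists>x\<ge>a. x \<le> b \<and> charge P x = y"
    using y ab continuous_on_charge[OF P admissibleD(1)[OF a(1)] b(1)] by (intro IVT2') auto
  then obtain x where x: "a \<le> x" "x \<le> b" "charge P x = y" by blast
  have adm: "x \<in> admissible"
    using admissible_down[OF b(1)] admissibleD(1)[OF a(1)] x by simp
  moreover have "gap x \<le> P"
    using nu_gap_strict_mono(2)[OF adm b(1)] x b(2) by (cases "x = b") auto
  ultimately show thesis
    using x(3) that by blast
qed

section \<open>The number d_c and the energy of its family\<close>

lemma d_per_closing:
  assumes c: "1 < c" and d: "0 < d" "d < 1" "closing \<rho> c d"
  shows "d_per \<rho> c = d"
  unfolding d_per_def
proof (rule the_equality)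
  show "0 < d \<and> d < 1 \<and> (\<forall>e\<in>{-1..1}. \<exists>\<gamma>. associated \<rho> c d e \<gamma> \<and> periodic \<gamma>)"
    using c d by (auto simp: ex_periodic_associated_iff abs_le_iff)
next
  fix d' assume d': "0 < d' \<and> d' < 1 \<and> (\<forall>e\<in>{-1..1}. \<exists>\<gamma>. associated \<rho> c d' e \<gamma> \<and> periodic \<gamma>)"
  \<comment> \<open>The single value \<open>e = 0\<close> already forces the closing
    condition.\<close>
  then have "\<exists>\<gamma>. associated \<rho> c d' 0 \<gamma> \<and> periodic \<gamma>"
    by auto
  then have "closing \<rho> c d'"
    using ex_periodic_associated_iff[of c d' 0 \<rho>] c d' by simp
  then show "d' = d"
    using closing_unique[of c d' \<rho> d] c d d' by simp
qed

lemma closing_parameter_energy: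
  fixes \<rho> c :: real
  assumes c: "1 < c" and d: "0 < d" "d < 1" "closing \<rho> c d"
  defines "\<tau> \<equiv> \<rho>^2 / c^4"
  obtains m where "m \<in> admissible" "c^4 = (1 + \<tau>) * ((nu m)^2 + \<tau> * gap m) - \<tau>"
    "\<And>e \<gamma>. \<bar>e\<bar> \<le> 1 \<Longrightarrow> associated \<rho> c d e \<gamma> \<Longrightarrow> 2 * energy \<gamma> = (1 + \<tau>)^3 * gap m"
proof -
  have c0: "0 < c"
    using c by simp
  obtain m where m: "m \<in> admissible" "c^4 = (1 + \<tau>) * ((nu m)^2 + \<tau> * gap m) - \<tau>"
    "2 * d^2 * c^2 = c^2 + \<tau> - (1 - 2 * m) * nu m * (1 + \<tau>)"
    using closing_imp_parameter[OF c0 d] unfolding \<tau>_def by blast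
  have "2 * energy \<gamma> = (1 + \<tau>)^3 * gap m" if "\<bar>e\<bar> \<le> 1" "associated \<rho> c d e \<gamma>" for e \<gamma>
    using energy_closing[OF c0 d(1,2) that(1) m(3,2)] energy_associated[OF that(2)]
    by (simp add: \<tau>_def)
  with m(1,2) show thesis
    by (rule that)
qed

text \<open>Both parameters have charge \<open>\<rho>^2\<close>, so they agree by monotonicity;
  \<open>shrink\<close> then fixes \<tau>.\<close>

lemma closing_energy_unique:
  fixes \<rho> :: real
  assumes P: "0 < P"
    and c: "1 < c" "c^4 = (1 + \<rho>^2 / c^4) * ((nu m)^2 + \<rho>^2 / c^4 * gap m) - \<rho>^2 / c^4"
      "m \<in> admissible" "P = (1 + \<rho>^2 / c^4)^3 * gap m"
    and c': "1 < c'" "c'^4 = (1 + \<rho>^2 / c'^4) * ((nu m')^2 + \<rho>^2 / c'^4 * gap m') - \<rho>^2 / c'^4"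
      "m' \<in> admissible" "P = (1 + \<rho>^2 / c'^4)^3 * gap m'"
  shows "c = c'"
proof -
  have le: "gap m \<le> P" "charge P m = \<rho>^2" "shrink P m = 1 / (1 + \<rho>^2 / c^4)"
    if "1 < c" "c^4 = (1 + \<rho>^2 / c^4) * ((nu m)^2 + \<rho>^2 / c^4 * gap m) - \<rho>^2 / c^4"
      "m \<in> admissible" "P = (1 + \<rho>^2 / c^4)^3 * gap m" for c m
  proof -
    have \<tau>: "0 \<le> \<rho>^2 / c^4"
      by simp
    show "shrink P m = 1 / (1 + \<rho>^2 / c^4)"
      by (rule charge_eq(1)[OF P that(3,4) \<tau>])
    have "charge P m = \<rho>^2 / c^4 * c^4"
      unfolding charge_eq(2)[OF P that(3,4) \<tau>] using that(2) by simp
    then show "charge P m = \<rho>^2"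
      using that(1) by simp
    have "1 \<le> (1 + \<rho>^2 / c^4)^3"
      using \<tau> by (intro one_le_power) simp
    then have "1 * gap m \<le> (1 + \<rho>^2 / c^4)^3 * gap m"
      using admissibleD(5)[OF that(3)] by (intro mult_right_mono) auto
    then show "gap m \<le> P"
      using that(4) by simp
  qed
  note l = le[OF c] and l' = le[OF c']
  have m: "m = m'"
    using charge_strict_antimono[OF P c(3) c'(3)] charge_strict_antimono[OF P c'(3) c(3)] l l'
    by (cases m m' rule: linorder_cases) auto
  have "1 / (1 + \<rho>^2 / c^4) = 1 / (1 + \<rho>^2 / c'^4)"
    using l(3) l'(3) m by metis
  then have "1 + \<rho>^2 / c^4 = 1 + \<rho>^2 / c'^4"
    by (simp only: divide_cancel_left) auto
  then have \<tau>: "\<rho>^2 / c^4 = \<rho>^2 / c'^4"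
    by (rule add_left_imp_eq)
  \<comment> \<open>Read off from the closing equations, because equality of the quotients
    \<open>\<rho>^2 / c^4\<close> says nothing when \<rho> = 0.\<close>
  have "c^4 = c'^4"
    by (rule trans[OF c(2)], rule trans[OF _ c'(2)[symmetric]]) (simp only: m \<tau>)
  then show ?thesis
    using c(1) c'(1) by (simp add: power_eq_iff_eq_base)
qed

text \<open>Choose \<open>m\<close> with charge \<open>\<rho>^2\<close> and obtain \<tau> from
  \<open>shrink\<close>. The closing equation then defines \<open>c^4\<close>, and the value of the
  charge ensures that \<open>\<rho>^2 / c^4\<close> is this same \<tau>.\<close>

lemma closing_energy_exists:
  fixes \<rho> :: real
  assumes P: "0 < P"
  obtains c m where "1 < c" "m \<in> admissible"
    "c^4 = (1 + \<rho>^2 / c^4) * ((nu m)^2 + \<rho>^2 / c^4 * gap m) - \<rho>^2 / c^4"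
    "P = (1 + \<rho>^2 / c^4)^3 * gap m"
proof -
  obtain m where m: "m \<in> admissible" "gap m \<le> P" "charge P m = \<rho>^2"
    using charge_surj[OF P zero_le_power2] .
  define \<tau> where "\<tau> = 1 / shrink P m - 1"
  note A = admissibleD[OF m(1)] and h = shrink_cube[OF P m(1)]
  have "shrink P m ^ 3 \<le> 1 ^ 3"
  proof -
    have "P * shrink P m ^ 3 \<le> P * 1"
      using h(2) m(2) by simp
    then show ?thesis
      using P by simp
  qed
  then have "shrink P m \<le> 1"
    using power_mono_iff[of "shrink P m" 1 3] h(1) by simp
  then have \<tau>: "0 \<le> \<tau>"
    using h(1) by (simp add: \<tau>_def)
  have P\<tau>: "P = (1 + \<tau>)^3 * gap m"
    using h by (simp add: \<tau>_def power_divide flip: h(2))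
  define s where "s = (1 + \<tau>) * ((nu m)^2 + \<tau> * gap m) - \<tau>"
  have s: "1 < s"
  proof -
    have "(1 + \<tau>) * 1 < (1 + \<tau>) * ((nu m)^2 + \<tau> * gap m)"
    proof (rule mult_strict_left_mono)
      have "1 < (nu m)^2"
        using A(4) by (simp add: one_less_power)
      moreover have "0 \<le> \<tau> * gap m"
        using \<tau> A(5) by simp
      ultimately show "1 < (nu m)^2 + \<tau> * gap m" by linarith
    qed (use \<tau> in simp)
    then show ?thesis
      by (simp add: s_def)
  qed
  have \<rho>: "\<rho>^2 = \<tau> * s"
    using charge_eq(2)[OF P m(1) P\<tau> \<tau>] m(3) by (simp add: s_def)
  define c where "c = root 4 s"
  have c: "1 < c" "c^4 = s"
    using s by (simp_all add: c_def)
  have "\<rho>^2 / c^4 = \<tau>"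
    using s by (simp add: c(2) \<rho>)
  then show thesis
    using that[of c m] c m(1) P\<tau> s_def by simp
qed

theorem theorem3p7:
  fixes \<rho> \<E> :: real
  assumes "\<rho> \<ge> 0" and "\<E> > 0"
  shows "infinite {\<gamma>. magnetic_trajectory \<rho> \<gamma> \<and> periodic \<gamma> \<and> energy \<gamma> = \<E> \<and> \<gamma> 0 = 0 \<and>
           (\<exists>x\<^sub>0 y\<^sub>0 z\<^sub>0. velocity \<gamma> 0 = x\<^sub>0 *\<^sub>R e1 0 + y\<^sub>0 *\<^sub>R e2 0 + z\<^sub>0 *\<^sub>R e3 0 \<and> x\<^sub>0 \<ge> 0)}
       \<and> (\<exists>!c. c > 1 \<and> (\<forall>e\<in>{-1..1}. \<exists>\<gamma>. associated \<rho> c (d_per \<rho> c) e \<gamma> \<and>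
           periodic \<gamma> \<and> energy \<gamma> = \<E>))"
    (is "infinite ?S \<and> (\<exists>!c. ?Q c)")
proof
  have P: "0 < 2 * \<E>"
    using assms by simp
  \<comment> \<open>Every \<open>c\<close> with the required property yields an admissible
    \<open>m\<close>, by inspecting the trajectory for \<open>e = 0\<close>; uniqueness of
    \<open>c\<close> is then a statement about parameters.\<close>
  have par: "\<exists>m. m \<in> admissible \<and>
      c^4 = (1 + \<rho>^2 / c^4) * ((nu m)^2 + \<rho>^2 / c^4 * gap m) - \<rho>^2 / c^4 \<and>
      2 * \<E> = (1 + \<rho>^2 / c^4)^3 * gap m" if Q: "?Q c" for c
  proof -
    have c: "1 < c"
      using Q by simp
    obtain d where d: "0 < d" "d < 1" "closing \<rho> c d"
      using closing_exists[OF c] .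
    obtain m where m: "m \<in> admissible"
      "c^4 = (1 + \<rho>^2 / c^4) * ((nu m)^2 + \<rho>^2 / c^4 * gap m) - \<rho>^2 / c^4"
      "\<And>e \<gamma>. \<bar>e\<bar> \<le> 1 \<Longrightarrow> associated \<rho> c d e \<gamma> \<Longrightarrow> 2 * energy \<gamma> = (1 + \<rho>^2 / c^4)^3 * gap m"
      using closing_parameter_energy[OF c d] by blast
    have "0 \<in> {-1..1::real}"
      by simp
    then obtain \<gamma> where "associated \<rho> c d 0 \<gamma>" "energy \<gamma> = \<E>"
      using Q unfolding d_per_closing[OF c d] by blast
    then show ?thesis
      using m(1,2) m(3)[of 0 \<gamma>] by auto
  qed
  obtain c m where c: "1 < c" and m: "m \<in> admissible"
    "c^4 = (1 + \<rho>^2 / c^4) * ((nu m)^2 + \<rho>^2 / c^4 * gap m) - \<rho>^2 / c^4"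
    "2 * \<E> = (1 + \<rho>^2 / c^4)^3 * gap m"
    using closing_energy_exists[OF P] .
  have c0: "0 < c"
    using c by simp
  obtain d where d: "0 < d" "d < 1" "closing \<rho> c d"
    "2 * d^2 * c^2 = c^2 + \<rho>^2 / c^4 - (1 - 2 * m) * nu m * (1 + \<rho>^2 / c^4)"
    using parameter_imp_closing[OF c0 m(1,2)] .
  have traj: "\<exists>\<gamma>. associated \<rho> c d e \<gamma> \<and> periodic \<gamma> \<and> energy \<gamma> = \<E>" if e: "\<bar>e\<bar> \<le> 1" for e
  proof -
    obtain \<gamma> where \<gamma>: "associated \<rho> c d e \<gamma>" "periodic \<gamma>"
      using ex_periodic_associated_iff[OF c0 d(1,2) e] d(3) by blast
    have "energy \<gamma> = \<E>"
      using energy_associated[OF \<gamma>(1)] energy_closing[OF c0 d(1,2) e d(4) m(2) refl] m(3) by simp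
    with \<gamma> show ?thesis by blast
  qed
  have Qc: "?Q c"
    using c traj unfolding d_per_closing[OF c d(1-3)] by (auto simp: abs_le_iff)
  show "\<exists>!c. ?Q c"
  proof (rule ex1I[of _ c])
    fix c' assume Q': "?Q c'"
    then obtain m' where "m' \<in> admissible"
      "c'^4 = (1 + \<rho>^2 / c'^4) * ((nu m')^2 + \<rho>^2 / c'^4 * gap m') - \<rho>^2 / c'^4"
      "2 * \<E> = (1 + \<rho>^2 / c'^4)^3 * gap m'"
      using par by blast
    then show "c' = c"
      using closing_energy_unique[OF P _ _ _ _ c m(2,1,3)] Q' by blast
  qed (rule Qc)
  show "infinite ?S"
  proof -
    obtain \<Gamma> where \<Gamma>: "\<And>e. \<bar>e\<bar> \<le> 1 \<Longrightarrow> associated \<rho> c d e (\<Gamma> e) \<and> periodic (\<Gamma> e) \<and> energy (\<Gamma> e) = \<E>"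
      using traj by metis
    \<comment> \<open>Distinct \<open>e\<close> give distinct initial velocities: \<open>z0\<close>
      is affine in \<open>e\<close> with slope \<open>2 * c * d > 0\<close>.\<close>
    have "inj_on \<Gamma> {-1..1}"
    proof (rule inj_onI)
      fix e e' assume e: "e \<in> {-1..1}" "e' \<in> {-1..1}" and eq: "\<Gamma> e = \<Gamma> e'"
      have "associated \<rho> c d e (\<Gamma> e)" "associated \<rho> c d e' (\<Gamma> e)"
        using \<Gamma>[of e] \<Gamma>[of e'] e eq by (auto simp: abs_le_iff)
      then have "z0 \<rho> c d e = z0 \<rho> c d e'"
        by (simp add: associated_def frame_at_identity vec_eq_iff forall_3)
      then show "e = e'"
        using c0 d(1) by (simp add: z0_def)
    qed
    then have "infinite (\<Gamma> ` {-1..1})"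
      by (simp add: finite_image_iff infinite_Icc)
    moreover have "\<Gamma> ` {-1..1} \<subseteq> ?S"
    proof (rule image_subsetI)
      fix e :: real assume "e \<in> {-1..1}"
      then have e: "\<bar>e\<bar> \<le> 1"
        by (simp add: abs_le_iff)
      have "e^2 \<le> 1" "d^2 \<le> 1"
        using e d(1,2) by (simp_all add: abs_square_le_1)
      then have "0 \<le> x0 \<rho> c d e"
        using c0 d(1) by (simp add: x0_def)
      then show "\<Gamma> e \<in> ?S"
        using \<Gamma>[OF e] unfolding associated_def by blast
    qed
    ultimately show ?thesis
      using finite_subset by blast
  qed
qed

end
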